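(* Let $k\geq 4$ be an integer, let $0<\gamma<1$, and let $\mathcal{H}$ be a $2$-contractible $k$-tree with $s$ vertices, $t$ edges and cross-cut number $\sigma=\sigma(\mathcal{H})$. Then there exists $\beta>0$, depending on $\mathcal{H}$ and $\gamma$, such that for all sufficiently large $n$ the following holds: if $\mathcal{F}$ is a $k$-graph on $[n]$ with $|\mathcal{F}|=a\binom{n}{k-1}$ where $a\geq\sigma-1+\gamma$, then $\mathcal{F}$ contains at least $\beta a^t n^{s-t}$ copies of $\mathcal{H}$.
   Context: Hypertrees: a single edge is a hypertree; a hypergraph with at least two edges is a hypertree if it has an edge $E$ such that removing $E$ leaves a hypertree $\mathcal{H}'$ and some edge $F$ of $\mathcal{H}'$ satisfies $E\cap V(\mathcal{H}')=E\cap F$. A $k$-tree is a $k$-uniform hypertree; it is $2$-contractible if every edge contains at least two vertices of degree $1$. A cross-cut of $\mathcal{H}$ is a vertex set meeting every edge in exactly one vertex; $\sigma(\mathcal{H})$ is the minimum size of a cross-cut. *)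

theory Defs
  imports Complex_Main
begin

text \<open>
  A hypergraph is given by its set of edges. All hypergraphs in question have no isolated
  vertices, so the vertex set is the union of the edges.
\<close>

definition hverts :: "'a set set \<Rightarrow> 'a set" where
  "hverts H = \<Union>H"

definition hdegree :: "'a set set \<Rightarrow> 'a \<Rightarrow> nat" where
  "hdegree H v = card {E \<in> H. v \<in> E}"

definition uniform :: "nat \<Rightarrow> 'a set set \<Rightarrow> bool" where
  "uniform k H \<longleftrightarrow> (\<forall>E\<in>H. finite E \<and> card E = k)"

inductive hypertree :: "'a set set \<Rightarrow> bool" where
  single: "hypertree {E}"
| extend: "\<lbrakk>hypertree H'; E \<notin> H'; F \<in> H'; E \<inter> hverts H' = E \<inter> F\<rbrakk> \<Longrightarrow> hypertree (insert E H')"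

definition k_tree :: "nat \<Rightarrow> 'a set set \<Rightarrow> bool" where
  "k_tree k H \<longleftrightarrow> hypertree H \<and> uniform k H"

definition two_contractible :: "'a set set \<Rightarrow> bool" where
  "two_contractible H \<longleftrightarrow> (\<forall>E\<in>H. card {v \<in> E. hdegree H v = 1} \<ge> 2)"

definition cross_cut :: "'a set set \<Rightarrow> 'a set \<Rightarrow> bool" where
  "cross_cut H S \<longleftrightarrow> S \<subseteq> hverts H \<and> (\<forall>E\<in>H. card (E \<inter> S) = 1)"

text \<open>
  The minimum below is over a nonempty set whenever \<open>H\<close> is 2-contractible: one vertex
  of degree 1 from each edge gives a cross-cut.
\<close>

definition cross_cut_number :: "'a set set \<Rightarrow> nat" where
  "cross_cut_number H = (LEAST m. \<exists>S. cross_cut H S \<and> card S = m)"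

definition hg_iso :: "'a set set \<Rightarrow> 'b set set \<Rightarrow> bool" where
  "hg_iso H G \<longleftrightarrow> (\<exists>f. bij_betw f (hverts H) (hverts G) \<and> (\<lambda>E. f ` E) ` H = G)"

text \<open>
  Copies are unlabelled: subhypergraphs isomorphic to \<open>H\<close>, not embeddings of \<open>H\<close>.
\<close>

definition copies :: "'a set set \<Rightarrow> 'b set set \<Rightarrow> 'b set set set" where
  "copies H F = {G. G \<subseteq> F \<and> hg_iso H G}"

end

theory Submission
  imports Defs "HOL-Library.FuncSet"
begin

text \<open>
  Labelled copies of \<open>H\<close> are counted by adding the edges of the hypertree one at a time. This
  succeeds in a family in which every relevant subset \<open>D\<close> of an edge is robust: after forbidding
  boundedly many vertices, about \<open>a n\<^bsup>k-1-|D|\<^esup>\<close> edges through \<open>D\<close> remain. For large \<open>a\<close>, deleting the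
  edges through sets of low degree is enough.

  For bounded \<open>a\<close>, a constant proportion of the family is made \<open>k\<close>-partite and homogeneous: each set
  \<open>A\<close> of colours either determines a further colour (in every edge, the \<open>A\<close>-part fixes the vertex of
  that colour), or all \<open>A\<close>-parts of edges are robust. The colour sets of the second kind are closed
  under intersection, and every \<open>(k-2)\<close>-set of colours lies in a proper one of them, because the family
  has order \<open>n\<^bsup>k-1\<^esup>\<close>. Hence either all colour sets missing some two colours \<open>x, y\<close> are robust, and \<open>H\<close>
  embeds with two degree-1 vertices of each edge coloured \<open>x, y\<close>; or there is a colour \<open>x\<close> determined
  by all \<open>(k-2)\<close>-sets of other colours, and then a shadow bound of Kruskal--Katona type yields a vertex
  of degree of order \<open>n\<^bsup>k-1\<^esup>\<close>.

  So, if there are few copies, all but \<open>o(n\<^bsup>k-1\<^esup>)\<close> edges meet the bounded set \<open>X\<close> of vertices of such degree in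
  exactly one vertex. Since \<open>a \<ge> \<sigma> - 1 + \<gamma>\<close>, some \<open>\<sigma>\<close> vertices of \<open>X\<close> have a common link of positive
  density; sending a minimum cross-cut to them, the rest of \<open>H\<close> embeds into this dense link.
\<close>

section \<open>Greedy embedding\<close>

text \<open>Extensionality makes every labelled embedding a single function, so that embeddings can
  be counted. The last conjunct fixes \<open>Z\<close> as the set of vertices of \<open>H\<close>
  sent into \<open>U\<close>; it is vacuous for \<open>Z = U = {}\<close>.\<close>

definition emb :: "'a set set \<Rightarrow> 'b set set \<Rightarrow> 'a set \<Rightarrow> 'b set \<Rightarrow> ('a \<Rightarrow> 'b) set" where
  "emb H G Z U = {f \<in> extensional (hverts H). inj_on f (hverts H) \<and> (\<forall>E\<in>H. f ` E \<in> G) \<and>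
     (\<forall>v\<in>hverts H. f v \<in> U \<longleftrightarrow> v \<in> Z)}"

lemma hverts_insert: "hverts (insert E H) = E \<union> hverts H"
  by (simp add: hverts_def)

lemma hypertree_finite: "hypertree H \<Longrightarrow> finite H"
  by (induction rule: hypertree.induct) auto

lemma hypertree_nonempty: "hypertree H \<Longrightarrow> H \<noteq> {}"
  by (induction rule: hypertree.induct) auto

lemma finite_hverts: "finite H \<Longrightarrow> uniform k H \<Longrightarrow> finite (hverts H)"
  by (auto simp: hverts_def uniform_def)

lemma finite_emb:
  assumes "finite (hverts H)" "finite (hverts G)"
  shows "finite (emb H G Z U)"
proof -
  have "f v \<in> hverts G" if "f \<in> emb H G Z U" "v \<in> hverts H" for f v
    using that unfolding emb_def hverts_def by blast
  then have "emb H G Z U \<subseteq> hverts H \<rightarrow>\<^sub>E hverts G"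
    unfolding PiE_def emb_def by blast
  moreover have "finite (hverts H \<rightarrow>\<^sub>E hverts G)"
    using assms by (rule finite_PiE)
  ultimately show ?thesis
    by (rule finite_subset)
qed

text \<open>The parts inside \<open>Z\<close> and \<open>U\<close> have equal size, hence so do the
  parts outside; bijections of the two pairs of parts are glued.\<close>

lemma ex_bij_betw_respecting:
  assumes "finite A" "finite B" "card A = card B" "card (A \<inter> Z) = card (B \<inter> U)"
  shows "\<exists>h. bij_betw h A B \<and> (\<forall>v\<in>A. h v \<in> U \<longleftrightarrow> v \<in> Z)"
proof -
  have "card (A - Z) = card A - card (A \<inter> Z)" "card (B - U) = card B - card (B \<inter> U)"
    using assms by (simp_all add: card_Diff_subset_Int)
  then have "card (A - Z) = card (B - U)"
    using assms by simp
  then obtain h1 h2 where h: "bij_betw h1 (A \<inter> Z) (B \<inter> U)" "bij_betw h2 (A - Z) (B - U)"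
    using assms finite_same_card_bij by (metis finite_Diff finite_Int)
  define h where "h v = (if v \<in> A \<inter> Z then h1 v else h2 v)" for v
  have "bij_betw h ((A \<inter> Z) \<union> (A - Z)) ((B \<inter> U) \<union> (B - U))"
    unfolding h_def by (rule bij_betw_disjoint_Un[OF h]) auto
  moreover have "(A \<inter> Z) \<union> (A - Z) = A" "(B \<inter> U) \<union> (B - U) = B" by auto
  moreover have "h v \<in> U \<longleftrightarrow> v \<in> Z" if "v \<in> A" for v
    using that h by (auto simp: h_def bij_betw_def)
  ultimately show ?thesis by metis
qed

text \<open>The old vertices keep their images, and the new vertices of \<open>E\<close> are sent
  bijectively to the rest of \<open>E'\<close>, which the last assumption keeps disjoint from the
  old image.\<close>

lemma emb_extend:
  assumes f: "f \<in> emb H' G Z U" and F: "F \<in> H'" and EF: "E \<inter> hverts H' = E \<inter> F"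
    and fin: "finite E" "finite E'" and cE: "card E = card E'" and cZ: "card (E \<inter> Z) = card (E' \<inter> U)"
    and EFZ: "E \<inter> F \<inter> Z = {}"
    and E': "E' \<in> G" "f ` (E \<inter> F) \<subseteq> E'" "E' \<inter> (f ` hverts H' - f ` (E \<inter> F)) = {}"
  shows "\<exists>g \<in> emb (insert E H') G Z U. restrict g (hverts H') = f \<and> g ` E = E'"
proof -
  define D where "D = E \<inter> F"
  have Dsub: "D \<subseteq> hverts H'" using F by (auto simp: D_def hverts_def)
  have injf: "inj_on f (hverts H')" and fU: "\<And>v. v \<in> hverts H' \<Longrightarrow> f v \<in> U \<longleftrightarrow> v \<in> Z"
    and fG: "\<And>E. E \<in> H' \<Longrightarrow> f ` E \<in> G" and fext: "f \<in> extensional (hverts H')"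
    using f by (auto simp: emb_def)
  have cD: "card (f ` D) = card D"
    using injf Dsub by (intro card_image) (rule inj_on_subset)
  have "card (E - D) = card E - card D"
    using fin by (intro card_Diff_subset) (auto simp: D_def)
  moreover have "card (E' - f ` D) = card E' - card (f ` D)"
    using fin E' by (intro card_Diff_subset) (auto simp: D_def)
  \<comment> \<open>The attaching set \<open>D\<close> avoids \<open>Z\<close>, so its image avoids
    \<open>U\<close>. Thus the counts of \<open>Z\<close> in \<open>E\<close> and of
    \<open>U\<close> in \<open>E'\<close> are already counts over the new vertices.\<close>
  moreover have "(E - D) \<inter> Z = E \<inter> Z" using EFZ by (auto simp: D_def)
  moreover have "(E' - f ` D) \<inter> U = E' \<inter> U"
    using EFZ fU Dsub by (auto simp: D_def)
  ultimately have "\<exists>h. bij_betw h (E - D) (E' - f ` D) \<and> (\<forall>v\<in>E - D. h v \<in> U \<longleftrightarrow> v \<in> Z)"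
    using fin cE cZ cD by (intro ex_bij_betw_respecting) auto
  then obtain h where h: "bij_betw h (E - D) (E' - f ` D)" and hU: "\<forall>v\<in>E - D. h v \<in> U \<longleftrightarrow> v \<in> Z"
    by blast
  have ED: "E - D = E - hverts H'" using EF by (auto simp: D_def)
  define g where "g v = (if v \<in> hverts H' then f v else if v \<in> E then h v else undefined)" for v
  have gf: "g v = f v" if "v \<in> hverts H'" for v using that by (simp add: g_def)
  have gh: "g v = h v" if "v \<in> E - D" for v using that ED by (simp add: g_def)
  have gD: "g ` D = f ` D" using gf Dsub by (auto intro!: image_cong)
  have gED: "g ` (E - D) = E' - f ` D" using gh h by (auto simp: bij_betw_def intro!: image_cong)
  have "E = D \<union> (E - D)" by (auto simp: D_def)
  then have gE: "g ` E = E'" using gD gED E' by (metis D_def Diff_partition image_Un)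
  have restr: "restrict g (hverts H') = f"
    using fext by (auto simp: gf restrict_def extensional_def fun_eq_iff)
  have V: "hverts (insert E H') = hverts H' \<union> (E - D)"
    using ED by (auto simp: hverts_insert)
  have "inj_on g (hverts H' \<union> (E - D))"
  proof (rule inj_on_Un[THEN iffD2], intro conjI)
    show "inj_on g (hverts H')" using injf gf by (auto simp: inj_on_def)
    show "inj_on g (E - D)" using h gh by (auto simp: inj_on_def bij_betw_def)
    have "g ` hverts H' = f ` hverts H'" using gf by (auto intro!: image_cong)
    then have "g ` hverts H' \<inter> g ` (E - D) = {}"
      unfolding gED using E' by (auto simp: D_def)
    then show "g ` (hverts H' - (E - D)) \<inter> g ` (E - D - hverts H') = {}"
      by blast
  qed
  moreover have "g ` A \<in> G" if "A \<in> insert E H'" for A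
  proof (cases "A = E")
    case False
    then have "A \<in> H'" using that by simp
    then have "g ` A = f ` A" using gf by (auto simp: hverts_def intro!: image_cong)
    then show ?thesis using fG \<open>A \<in> H'\<close> by simp
  qed (simp add: gE E')
  moreover have "g v \<in> U \<longleftrightarrow> v \<in> Z" if "v \<in> hverts (insert E H')" for v
    using that unfolding V using gf gh fU hU by auto
  moreover have "g \<in> extensional (hverts (insert E H'))"
    by (auto simp: extensional_def g_def hverts_insert)
  ultimately have "g \<in> emb (insert E H') G Z U"
    by (simp add: emb_def V)
  then show ?thesis using restr gE by blast
qed

text \<open>An extension remembers both the embedding \<open>f\<close> that it restricts to and the
  edge \<open>E'\<close> used for \<open>E\<close>, so different pairs have different
  extensions.\<close>

lemma card_emb_insert_ge:
  assumes fin: "finite (emb H' G Z U)" "finite (emb (insert E H') G Z U)" "finite G"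
    and ext: "\<And>f E'. f \<in> emb H' G Z U \<Longrightarrow> E' \<in> S f \<Longrightarrow>
      \<exists>g \<in> emb (insert E H') G Z U. restrict g (hverts H') = f \<and> g ` E = E'"
    and S: "\<And>f. f \<in> emb H' G Z U \<Longrightarrow> S f \<subseteq> G \<and> b \<le> real (card (S f))"
  shows "b * real (card (emb H' G Z U)) \<le> real (card (emb (insert E H') G Z U))"
proof -
  have "Sigma (emb H' G Z U) S \<subseteq> (\<lambda>g. (restrict g (hverts H'), g ` E)) ` emb (insert E H') G Z U"
    using ext by (force simp: image_iff)
  then have "card (Sigma (emb H' G Z U) S) \<le> card (emb (insert E H') G Z U)"
    using fin(2) by (rule surj_card_le[rotated])
  then have le: "real (card (Sigma (emb H' G Z U) S)) \<le> real (card (emb (insert E H') G Z U))"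
    by simp
  have "card (Sigma (emb H' G Z U) S) = (\<Sum>f\<in>emb H' G Z U. card (S f))"
    using fin S by (intro card_SigmaI) (auto intro: finite_subset)
  then have "(\<Sum>f\<in>emb H' G Z U. real (card (S f))) = real (card (Sigma (emb H' G Z U) S))"
    by simp
  moreover have "b * real (card (emb H' G Z U)) \<le> (\<Sum>f\<in>emb H' G Z U. real (card (S f)))"
    using sum_bounded_below[of "emb H' G Z U" b "\<lambda>f. real (card (S f))"] S by (simp add: mult.commute)
  ultimately show ?thesis
    using le by linarith
qed

text \<open>
  \<open>Z\<close> and \<open>U\<close> keep the attaching sets away from \<open>U\<close>, so robustness is only needed for sets disjoint
  from \<open>U\<close>.
\<close>

lemma card_emb_ge:
  fixes B N :: real
  assumes "hypertree H" "uniform r H" "card (hverts H) \<le> q"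
    and "\<And>E F. E \<in> H \<Longrightarrow> F \<in> H \<Longrightarrow> E \<noteq> F \<Longrightarrow> E \<inter> F \<inter> Z = {}"
    and "\<And>E. E \<in> H \<Longrightarrow> card (E \<inter> Z) = m"
    and G: "finite G" "uniform r G" "G \<noteq> {}" "r > 0" "\<And>E. E \<in> G \<Longrightarrow> card (E \<inter> U) = m"
    and pos: "B \<ge> 0" "N \<ge> 0"
    and rob: "\<And>E D W. E \<in> G \<Longrightarrow> D \<subset> E \<Longrightarrow> D \<inter> U = {} \<Longrightarrow> finite W \<Longrightarrow> card W \<le> q \<Longrightarrow> W \<inter> D = {} \<Longrightarrow>
       B * N ^ (r - card D) \<le> real (card {E' \<in> G. D \<subseteq> E' \<and> E' \<inter> W = {}})"
  shows "B ^ card H * N ^ card (hverts H) \<le> real (card (emb H G Z U))"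
  using assms(1-5)
proof (induction rule: hypertree.induct)
  case (single E)
  have fG: "finite (hverts G)" using G finite_hverts by blast
  have E: "finite E" "card E = r" using single by (auto simp: uniform_def)
  obtain E0 where "E0 \<in> G" using G by auto
  \<comment> \<open>Robustness of the empty set, with nothing forbidden, counts the choices for the
    first edge.\<close>
  have "{} \<subset> E0" using G \<open>E0 \<in> G\<close> by (auto simp: uniform_def)
  from rob[OF \<open>E0 \<in> G\<close> this, of "{}"] have first: "B * N ^ r \<le> real (card G)" by simp
  have fin: "finite (emb {E} G Z U)" using fG E by (intro finite_emb) (auto simp: hverts_def)
  have "G \<subseteq> (\<lambda>g. g ` E) ` emb {E} G Z U"
  proof
    fix E' assume E': "E' \<in> G"
    then have "\<exists>h. bij_betw h E E' \<and> (\<forall>v\<in>E. h v \<in> U \<longleftrightarrow> v \<in> Z)"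
      using G E single.prems by (intro ex_bij_betw_respecting) (auto simp: uniform_def)
    then obtain h where h: "bij_betw h E E'" "\<forall>v\<in>E. h v \<in> U \<longleftrightarrow> v \<in> Z" by blast
    have "restrict h E \<in> emb {E} G Z U" "restrict h E ` E = E'"
      using h E' by (auto simp: emb_def hverts_def bij_betw_def)
    then show "E' \<in> (\<lambda>g. g ` E) ` emb {E} G Z U" by (metis imageI)
  qed
  then have "card G \<le> card (emb {E} G Z U)" using fin by (rule surj_card_le[rotated])
  then show ?case using first E by (simp add: hverts_def)
next
  case (extend H' E F)
  have fG: "finite (hverts G)" using G finite_hverts by blast
  have E: "finite E" "card E = r" "finite F" "card F = r" using extend by (auto simp: uniform_def)
  have uH': "uniform r H'" using extend.prems by (auto simp: uniform_def)
  have fH': "finite H'" using extend.hyps hypertree_finite by blast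
  have fV: "finite (hverts H')" using fH' uH' finite_hverts by blast
  have fV2: "finite (hverts (insert E H'))" using fV E by (simp add: hverts_insert)
  have cV: "card (hverts H') \<le> q"
    using extend.prems(2) card_mono[OF fV2, of "hverts H'"] by (simp add: hverts_insert)
  have IH: "B ^ card H' * N ^ card (hverts H') \<le> real (card (emb H' G Z U))"
    using extend.prems uH' cV by (intro extend.IH) auto
  have EF: "E \<noteq> F" using extend by auto
  define D where "D = E \<inter> F"
  \<comment> \<open>The admissible images of \<open>E\<close>: edges through the image of the
    attaching set that avoid every other used vertex.\<close>
  define S where "S f = {E' \<in> G. f ` D \<subseteq> E' \<and> E' \<inter> (f ` hverts H' - f ` D) = {}}" for f
  have DF: "D \<subset> F" using EF E by (metis D_def card_subset_eq inf.absorb_iff2 inf_le2 psubsetI)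
  have step: "(B * N ^ (r - card D)) * real (card (emb H' G Z U)) \<le> real (card (emb (insert E H') G Z U))"
  proof (rule card_emb_insert_ge[where S = S])
    show "finite (emb H' G Z U)" "finite (emb (insert E H') G Z U)"
      using fV fV2 fG finite_emb by blast+
    show "finite G" by fact
  next
    fix f E' assume fE: "f \<in> emb H' G Z U" "E' \<in> S f"
    have E': "E' \<in> G" "finite E'" "card E' = r" using fE G by (auto simp: S_def uniform_def)
    have "E \<inter> F \<inter> Z = {}" "card (E \<inter> Z) = m" using extend.prems extend.hyps EF by auto
    then show "\<exists>g\<in>emb (insert E H') G Z U. restrict g (hverts H') = f \<and> g ` E = E'"
      using fE E E' G(5) extend.hyps
      by (intro emb_extend[where F = F]) (auto simp: S_def D_def)
  next
    fix f assume f: "f \<in> emb H' G Z U"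
    have FV: "F \<subseteq> hverts H'" using extend.hyps by (auto simp: hverts_def)
    have inj: "inj_on f F" using f FV by (auto simp: emb_def intro: inj_on_subset)
    have sub: "f ` D \<subset> f ` F" using DF inj by (metis image_mono inj_on_image_eq_iff order_refl psubset_eq)
    have "f ` F \<in> G" using f extend.hyps by (auto simp: emb_def)
    have "D \<inter> Z = {}" using extend.prems extend.hyps EF by (auto simp: D_def)
    moreover have "D \<subseteq> hverts H'" using DF FV by auto
    ultimately have "f ` D \<inter> U = {}" using f by (fastforce simp: emb_def)
    moreover have "card (f ` hverts H' - f ` D) \<le> q"
      using card_mono[of "f ` hverts H'" "f ` hverts H' - f ` D"] card_image_le[OF fV, of f] cV fV by auto
    ultimately have "B * N ^ (r - card (f ` D)) \<le> real (card (S f))"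
      unfolding S_def using fV by (intro rob[OF \<open>f ` F \<in> G\<close> sub]) auto
    moreover have "card (f ` D) = card D" using inj DF by (intro card_image) (auto intro: inj_on_subset)
    ultimately show "S f \<subseteq> G \<and> B * N ^ (r - card D) \<le> real (card (S f))"
      by (auto simp: S_def)
  qed
  \<comment> \<open>The new edge adds \<open>r - card D\<close> vertices, exactly the exponent of
    \<open>N\<close> gained from robustness.\<close>
  have "hverts (insert E H') = hverts H' \<union> (E - D)" "hverts H' \<inter> (E - D) = {}"
    using extend.hyps by (auto simp: hverts_insert D_def)
  then have "card (hverts (insert E H')) = card (hverts H') + (r - card D)"
    using fV E by (simp add: card_Un_disjoint card_Diff_subset D_def)
  then have "B ^ card (insert E H') * N ^ card (hverts (insert E H'))
    = (B * N ^ (r - card D)) * (B ^ card H' * N ^ card (hverts H'))"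
    using extend.hyps fH' by (simp add: power_add)
  also have "\<dots> \<le> (B * N ^ (r - card D)) * real (card (emb H' G Z U))"
    using IH pos by (intro mult_left_mono) auto
  finally show ?case using step by linarith
qed

section \<open>From labelled embeddings to unlabelled copies\<close>

lemma hg_iso_card_hverts:
  assumes "hg_iso H G" "finite (hverts H)"
  shows "finite (hverts G)" "card (hverts G) = card (hverts H)"
proof -
  obtain f where "bij_betw f (hverts H) (hverts G)"
    using assms unfolding hg_iso_def by blast
  then show "finite (hverts G)" "card (hverts G) = card (hverts H)"
    using assms(2) by (simp_all add: bij_betw_finite bij_betw_same_card)
qed

text \<open>The image of an embedding is a copy, and a fixed copy on \<open>s\<close> vertices is
  the image of at most \<open>s ^ s\<close> maps from the \<open>s\<close> vertices of
  \<open>H\<close>.\<close>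

lemma card_emb_le_copies:
  assumes "finite (hverts H)" "finite F"
  shows "card (emb H F Z U) \<le> card (hverts H) ^ card (hverts H) * card (copies H F)"
proof -
  have "copies H F \<subseteq> Pow F" unfolding copies_def by blast
  then have fc: "finite (copies H F)" using assms(2) by (simp add: finite_subset)
  have G: "finite (hverts G)" "card (hverts G) = card (hverts H)" if "G \<in> copies H F" for G
    using that hg_iso_card_hverts[OF _ assms(1)] unfolding copies_def by blast+
  have "emb H F Z U \<subseteq> (\<Union>G\<in>copies H F. hverts H \<rightarrow>\<^sub>E hverts G)"
  proof
    fix f assume f: "f \<in> emb H F Z U"
    define G where "G = (\<lambda>E. f ` E) ` H"
    have hv: "hverts G = f ` hverts H" unfolding hverts_def G_def by blast
    have "bij_betw f (hverts H) (hverts G)" using f unfolding hv emb_def bij_betw_def by blast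
    moreover have "G \<subseteq> F" using f unfolding G_def emb_def by blast
    ultimately have "G \<in> copies H F"
      unfolding copies_def hg_iso_def using G_def by blast
    moreover have "f \<in> hverts H \<rightarrow>\<^sub>E hverts G"
      using f unfolding hv emb_def PiE_def by blast
    ultimately show "f \<in> (\<Union>G\<in>copies H F. hverts H \<rightarrow>\<^sub>E hverts G)" by blast
  qed
  then have "card (emb H F Z U) \<le> card (\<Union>G\<in>copies H F. hverts H \<rightarrow>\<^sub>E hverts G)"
    using fc assms(1) G(1) by (intro card_mono finite_UN_I finite_PiE)
  also have "\<dots> \<le> (\<Sum>G\<in>copies H F. card (hverts H \<rightarrow>\<^sub>E hverts G))"
    using fc by (rule card_UN_le)
  also have "\<dots> = (\<Sum>G\<in>copies H F. card (hverts H) ^ card (hverts H))"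
    using assms(1) G(2) by (intro sum.cong refl) (simp add: card_PiE)
  finally show ?thesis by (simp add: mult.commute)
qed
section \<open>Deleting sets of low degree\<close>

lemma real_card_UN_le:
  assumes "finite I"
  shows "real (card (\<Union>i\<in>I. A i)) \<le> (\<Sum>i\<in>I. real (card (A i)))"
  using card_UN_le[OF assms, of A] by (simp flip: of_nat_sum)

text \<open>Each \<open>D\<close> in \<open>P\<close> is deleted, with all edges through it, at a stage \<open>\<Gamma> D\<close> at which it is bad.\<close>

lemma cleaning:
  fixes G :: "'b set set" and bad :: "'b set set \<Rightarrow> 'b set \<Rightarrow> bool"
  assumes "finite G"
  shows "\<exists>Gs P \<Gamma>. Gs \<subseteq> G \<and> P \<subseteq> \<D> \<and> (\<forall>D\<in>\<D>. (\<exists>E\<in>Gs. D \<subseteq> E) \<longrightarrow> \<not> bad Gs D) \<and>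
    (\<forall>D\<in>P. bad (\<Gamma> D) D \<and> \<Gamma> D \<subseteq> G \<and> (\<exists>E\<in>G. D \<subseteq> E)) \<and>
    G - Gs \<subseteq> (\<Union>D\<in>P. {E \<in> \<Gamma> D. D \<subseteq> E})"
  using assms
proof (induction "card G" arbitrary: G rule: less_induct)
  case less
  show ?case
  proof (cases "\<forall>D\<in>\<D>. (\<exists>E\<in>G. D \<subseteq> E) \<longrightarrow> \<not> bad G D")
    case True
    then show ?thesis by (intro exI[of _ G] exI[of _ "{}"]) auto
  next
    case False
    then obtain D0 E0 where D0: "D0 \<in> \<D>" "bad G D0" and E0: "E0 \<in> G" "D0 \<subseteq> E0" by blast
    define G' where "G' = {E \<in> G. \<not> D0 \<subseteq> E}"
    have "G' \<subset> G" using E0 by (auto simp: G'_def)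
    then have "card G' < card G" "finite G'" using less.prems by (auto simp: psubset_card_mono finite_subset)
    from less.hyps[OF this] obtain Gs P \<Gamma> where IH: "Gs \<subseteq> G'" "P \<subseteq> \<D>"
      "\<forall>D\<in>\<D>. (\<exists>E\<in>Gs. D \<subseteq> E) \<longrightarrow> \<not> bad Gs D"
      "\<forall>D\<in>P. bad (\<Gamma> D) D \<and> \<Gamma> D \<subseteq> G' \<and> (\<exists>E\<in>G'. D \<subseteq> E)"
      "G' - Gs \<subseteq> (\<Union>D\<in>P. {E \<in> \<Gamma> D. D \<subseteq> E})"
      by (elim exE conjE) (rule that)
    \<comment> \<open>Members of \<open>P\<close> lie in edges of \<open>G'\<close>, none of which
      contains \<open>D0\<close>; setting \<open>\<Gamma>\<close> at \<open>D0\<close> to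
      \<open>G\<close> therefore overwrites no recorded stage.\<close>
    have "D0 \<notin> P" using IH(4) by (auto simp: G'_def)
    have "G - Gs \<subseteq> (\<Union>D\<in>insert D0 P. {E \<in> (\<Gamma>(D0 := G)) D. D \<subseteq> E})"
    proof
      fix E assume E: "E \<in> G - Gs"
      show "E \<in> (\<Union>D\<in>insert D0 P. {E \<in> (\<Gamma>(D0 := G)) D. D \<subseteq> E})"
      proof (cases "D0 \<subseteq> E")
        case True
        then show ?thesis using E by auto
      next
        case False
        then have "E \<in> G' - Gs" using E by (auto simp: G'_def)
        then obtain D where "D \<in> P" "E \<in> \<Gamma> D" "D \<subseteq> E" using IH(5) by blast
        then show ?thesis using \<open>D0 \<notin> P\<close> by (intro UN_I[of D]) auto
      qed
    qed
    moreover have "\<forall>D\<in>insert D0 P. bad ((\<Gamma>(D0 := G)) D) D \<and> (\<Gamma>(D0 := G)) D \<subseteq> G \<and> (\<exists>E\<in>G. D \<subseteq> E)"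
      using IH(4) D0 E0 \<open>D0 \<notin> P\<close> \<open>G' \<subset> G\<close> by (auto 4 4)
    ultimately show ?thesis
      using IH(1,2,3) D0 \<open>G' \<subset> G\<close>
      by (intro exI[of _ Gs] exI[of _ "insert D0 P"] exI[of _ "\<Gamma>(D0 := G)"]) auto
  qed
qed

text \<open>Each \<open>D\<close> is deleted at most once, at a moment when fewer than
  \<open>w D\<close> edges contain it, so the weights bound the total loss.\<close>

lemma min_degree_subfamily:
  fixes w :: "'b set \<Rightarrow> real"
  assumes "finite G" "finite \<D>" "\<And>D. D \<in> \<D> \<Longrightarrow> w D \<ge> 0"
  shows "\<exists>Gs \<subseteq> G. (\<forall>D\<in>\<D>. (\<exists>E\<in>Gs. D \<subseteq> E) \<longrightarrow> w D \<le> real (card {E \<in> Gs. D \<subseteq> E})) \<and>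
    real (card (G - Gs)) \<le> (\<Sum>D\<in>\<D>. w D)"
proof -
  define bad where "bad G D \<longleftrightarrow> real (card {E \<in> G. D \<subseteq> E}) < w D" for G and D :: "'b set"
  obtain Gs P \<Gamma> where Gs: "Gs \<subseteq> G" "P \<subseteq> \<D>"
    and good: "\<forall>D\<in>\<D>. (\<exists>E\<in>Gs. D \<subseteq> E) \<longrightarrow> \<not> bad Gs D"
    and lost: "\<forall>D\<in>P. bad (\<Gamma> D) D \<and> \<Gamma> D \<subseteq> G \<and> (\<exists>E\<in>G. D \<subseteq> E)" "G - Gs \<subseteq> (\<Union>D\<in>P. {E \<in> \<Gamma> D. D \<subseteq> E})"
    using cleaning[OF assms(1), of \<D> bad] by (elim exE conjE) (rule that)
  have fP: "finite P" using assms Gs finite_subset by blast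
  have f\<Gamma>: "finite {E \<in> \<Gamma> D. D \<subseteq> E}" if "D \<in> P" for D
    using lost(1) that assms(1) by (metis finite_Collect_conjI finite_subset Collect_mem_eq)
  have "card (G - Gs) \<le> card (\<Union>D\<in>P. {E \<in> \<Gamma> D. D \<subseteq> E})"
    using lost(2) fP f\<Gamma> by (intro card_mono finite_UN_I)
  then have "real (card (G - Gs)) \<le> (\<Sum>D\<in>P. real (card {E \<in> \<Gamma> D. D \<subseteq> E}))"
    using real_card_UN_le[OF fP, of "\<lambda>D. {E \<in> \<Gamma> D. D \<subseteq> E}"] by linarith
  also have "\<dots> \<le> (\<Sum>D\<in>P. w D)"
    using lost(1) by (intro sum_mono) (auto simp: bad_def less_imp_le)
  also have "\<dots> \<le> (\<Sum>D\<in>\<D>. w D)"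
    using assms Gs by (intro sum_mono2) auto
  finally show ?thesis
    using Gs(1) good by (intro exI[of _ Gs]) (auto simp: bad_def not_less)
qed

text \<open>Each size \<open>j < r\<close> contributes at most
  \<open>n ^ j * n ^ (r - 1 - j)\<close>. This is the total cost of deleting all sets
  \<open>D\<close> of degree below \<open>n ^ (r - 1 - card D)\<close>.\<close>

lemma sum_small_subsets_le:
  assumes "finite V" "card V = n"
  shows "(\<Sum>D | D \<subseteq> V \<and> card D < r. real n ^ (r - 1 - card D)) \<le> real r * real n ^ (r - 1)"
proof -
  have "(\<Sum>D | D \<subseteq> V \<and> card D < r. real n ^ (r - 1 - card D))
      = (\<Sum>j<r. \<Sum>D | D \<in> {D. D \<subseteq> V \<and> card D < r} \<and> card D = j. real n ^ (r - 1 - card D))"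
    using assms by (intro sum.group[symmetric]) auto
  also have "\<dots> \<le> (\<Sum>j<r. real n ^ (r - 1))"
  proof (rule sum_mono)
    fix j assume "j \<in> {..<r}"
    then have j: "j < r" by simp
    then have "{D \<in> {D. D \<subseteq> V \<and> card D < r}. card D = j} = {D. D \<subseteq> V \<and> card D = j}" by auto
    then have "(\<Sum>D | D \<in> {D. D \<subseteq> V \<and> card D < r} \<and> card D = j. real n ^ (r - 1 - card D))
      = real (n choose j) * real n ^ (r - 1 - j)"
      using assms by (simp add: n_subsets)
    also have "\<dots> \<le> real n ^ j * real n ^ (r - 1 - j)"
    proof (intro mult_right_mono)
      have "n choose j \<le> n ^ j"
        by (cases "j \<le> n") (auto simp: binomial_le_pow binomial_eq_0)
      then show "real (n choose j) \<le> real n ^ j"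
        by (metis of_nat_le_iff of_nat_power)
    qed simp
    also have "\<dots> = real n ^ (r - 1)" using j by (simp flip: power_add)
    finally show "(\<Sum>D | D \<in> {D. D \<subseteq> V \<and> card D < r} \<and> card D = j. real n ^ (r - 1 - card D))
      \<le> real n ^ (r - 1)" .
  qed
  finally show ?thesis by simp
qed

lemma card_supersets_le:
  assumes "finite V" "card V = n" "D \<subseteq> V"
  shows "real (card {E. D \<subseteq> E \<and> E \<subseteq> V \<and> card E = r}) \<le> real n ^ (r - card D)"
proof -
  have fin: "finite D" using assms finite_subset by blast
  have "inj_on (\<lambda>E. E - D) {E. D \<subseteq> E \<and> E \<subseteq> V \<and> card E = r}"
    by (auto simp: inj_on_def)
  moreover have "(\<lambda>E. E - D) ` {E. D \<subseteq> E \<and> E \<subseteq> V \<and> card E = r} \<subseteq> {E. E \<subseteq> V \<and> card E = r - card D}"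
    using fin by (auto simp: card_Diff_subset)
  ultimately have "card {E. D \<subseteq> E \<and> E \<subseteq> V \<and> card E = r} \<le> card {E. E \<subseteq> V \<and> card E = r - card D}"
    using assms by (intro card_inj_on_le) auto
  also have "\<dots> = n choose (r - card D)" using assms by (simp add: n_subsets)
  also have "\<dots> \<le> n ^ (r - card D)"
    by (cases "r - card D \<le> n") (auto simp: binomial_le_pow binomial_eq_0)
  finally show ?thesis by (metis of_nat_le_iff of_nat_power)
qed

section \<open>Embedding into families of large density\<close>

lemma emb_mono: "G \<subseteq> G' \<Longrightarrow> emb H G Z U \<subseteq> emb H G' Z U"
  unfolding emb_def by blast

lemma card_emb_mono:
  assumes "G \<subseteq> G'" "finite (hverts H)" "finite (hverts G')"
  shows "card (emb H G Z U) \<le> card (emb H G' Z U)"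
  using assms by (intro card_mono finite_emb emb_mono)

text \<open>
  With \<open>A\<close> constant this covers families with \<open>A n\<^bsup>r-1\<^esup>\<close> edges, with \<open>A = \<alpha> n\<close> families of positive density.
\<close>

lemma card_emb_ge_dense:
  fixes A :: real
  assumes V: "finite V" "card V = n" "n > 0" and F: "F \<subseteq> Pow V" "uniform r F" "r > 0"
    and H: "hypertree H" "uniform r H" "card (hverts H) \<le> q"
    and A: "A > 0" "A \<ge> 4 * real r * real q" "A * real n ^ (r - 1) \<le> real (card F)"
  shows "(A / (4 * real r * real n)) ^ card H * real n ^ card (hverts H) \<le> real (card (emb H F {} {}))"
proof -
  have fF: "finite F" using V F finite_subset by blast
  have fVF: "finite (hverts F)" using fF F finite_hverts by blast
  have fVH: "finite (hverts H)" using H hypertree_finite finite_hverts by blast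
  \<comment> \<open>With this threshold the deletions cost at most
    \<open>c * r * n ^ (r - 1)\<close>, which is half of the assumed lower bound for
    \<open>card F\<close>.\<close>
  define c where "c = A / (2 * real r)"
  have c: "c > 0" using A F by (simp add: c_def)
  define \<D> where "\<D> = {D. D \<subseteq> V \<and> card D < r}"
  have f\<D>: "finite \<D>" using V by (simp add: \<D>_def)
  obtain Gs where Gs: "Gs \<subseteq> F"
    and good: "\<And>D. D \<in> \<D> \<Longrightarrow> \<exists>E\<in>Gs. D \<subseteq> E \<Longrightarrow>
      c * real n ^ (r - 1 - card D) \<le> real (card {E \<in> Gs. D \<subseteq> E})"
    and lost: "real (card (F - Gs)) \<le> (\<Sum>D\<in>\<D>. c * real n ^ (r - 1 - card D))"
    using min_degree_subfamily[OF fF f\<D>, of "\<lambda>D. c * real n ^ (r - 1 - card D)"] c by auto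
  note lost
  also have "\<dots> \<le> c * (real r * real n ^ (r - 1))"
    using sum_small_subsets_le[OF V(1,2), of r] c by (simp add: \<D>_def flip: sum_distrib_left)
  also have "\<dots> = A / 2 * real n ^ (r - 1)" using F by (simp add: c_def)
  also have "\<dots> < A * real n ^ (r - 1)" using A V by simp
  finally have "card (F - Gs) < card F" using A by linarith
  then have "Gs \<noteq> {}" by auto
  have uGs: "uniform r Gs" and fGs: "finite Gs" using F Gs fF by (auto simp: uniform_def finite_subset)
  have "(A / (4 * real r * real n)) ^ card H * real n ^ card (hverts H) \<le> real (card (emb H Gs {} {}))"
  proof (rule card_emb_ge[OF H])
    fix E D W assume E: "E \<in> Gs" "D \<subset> E" and W: "finite W" "card W \<le> q" "W \<inter> D = {}"
    have "E \<subseteq> V" "finite E" "card E = r" using E Gs F by (auto simp: uniform_def)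
    then have cD: "card D < r" and "D \<subseteq> V" using E psubset_card_mono[of E D] by auto
    then have "D \<in> \<D>" by (simp add: \<D>_def)
    then have star: "c * real n ^ (r - 1 - card D) \<le> real (card {E \<in> Gs. D \<subseteq> E})" using good E by blast
    \<comment> \<open>An edge through \<open>D\<close> that meets \<open>W\<close> contains
      \<open>insert w D\<close> for some \<open>w\<close> in \<open>W\<close>, a set with one vertex
      more than \<open>D\<close>; this saves one factor \<open>n\<close> for each of the at most
      \<open>q\<close> vertices.\<close>
    have hit: "real (card {E \<in> Gs. D \<subseteq> E \<and> E \<inter> W \<noteq> {}}) \<le> real q * real n ^ (r - 1 - card D)"
    proof -
      have "{E \<in> Gs. D \<subseteq> E \<and> E \<inter> W \<noteq> {}} \<subseteq> (\<Union>w\<in>W \<inter> V. {E. insert w D \<subseteq> E \<and> E \<subseteq> V \<and> card E = r})"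
      proof
        fix E' assume E': "E' \<in> {E \<in> Gs. D \<subseteq> E \<and> E \<inter> W \<noteq> {}}"
        then have "E' \<subseteq> V" "card E' = r" using Gs F by (auto simp: uniform_def)
        moreover obtain w where "w \<in> E'" "w \<in> W" using E' by auto
        ultimately show "E' \<in> (\<Union>w\<in>W \<inter> V. {E. insert w D \<subseteq> E \<and> E \<subseteq> V \<and> card E = r})"
          using E' by (intro UN_I[of w]) auto
      qed
      then have "card {E \<in> Gs. D \<subseteq> E \<and> E \<inter> W \<noteq> {}} \<le> card (\<Union>w\<in>W \<inter> V. {E. insert w D \<subseteq> E \<and> E \<subseteq> V \<and> card E = r})"
        using W V by (intro card_mono finite_UN_I) auto
      then have "real (card {E \<in> Gs. D \<subseteq> E \<and> E \<inter> W \<noteq> {}})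
          \<le> (\<Sum>w\<in>W \<inter> V. real (card {E. insert w D \<subseteq> E \<and> E \<subseteq> V \<and> card E = r}))"
        using real_card_UN_le[of "W \<inter> V" "\<lambda>w. {E. insert w D \<subseteq> E \<and> E \<subseteq> V \<and> card E = r}"] W(1) by simp
      also have "\<dots> \<le> (\<Sum>w\<in>W \<inter> V. real n ^ (r - 1 - card D))"
      proof (rule sum_mono)
        fix w assume w: "w \<in> W \<inter> V"
        have "finite D" using \<open>D \<subseteq> V\<close> V finite_subset by blast
        moreover have "w \<notin> D" using w W by blast
        ultimately have "card (insert w D) = Suc (card D)" by simp
        then show "real (card {E. insert w D \<subseteq> E \<and> E \<subseteq> V \<and> card E = r}) \<le> real n ^ (r - 1 - card D)"
          using card_supersets_le[OF V(1,2), of "insert w D" r] w \<open>D \<subseteq> V\<close> by simp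
      qed
      also have "\<dots> = real (card (W \<inter> V)) * real n ^ (r - 1 - card D)" by simp
      also have "\<dots> \<le> real q * real n ^ (r - 1 - card D)"
        using card_mono[OF W(1), of "W \<inter> V"] W(2) by (intro mult_right_mono) auto
      finally show ?thesis .
    qed
    have "{E' \<in> Gs. D \<subseteq> E'} = {E' \<in> Gs. D \<subseteq> E' \<and> E' \<inter> W = {}} \<union> {E \<in> Gs. D \<subseteq> E \<and> E \<inter> W \<noteq> {}}"
      by auto
    then have "card {E' \<in> Gs. D \<subseteq> E'} \<le> card {E' \<in> Gs. D \<subseteq> E' \<and> E' \<inter> W = {}} + card {E \<in> Gs. D \<subseteq> E \<and> E \<inter> W \<noteq> {}}"
      by (simp add: card_Un_le)
    then have ge: "(c - real q) * real n ^ (r - 1 - card D) \<le> real (card {E' \<in> Gs. D \<subseteq> E' \<and> E' \<inter> W = {}})"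
      using star hit unfolding left_diff_distrib by linarith
    \<comment> \<open>The bound \<open>A \<ge> 4 * r * q\<close> says that \<open>q\<close> is at
      most half of \<open>c\<close>, so half of the minimum degree survives the removal of edges
      meeting \<open>W\<close>. The factor \<open>1 / n\<close> in the final bound accounts for the
      exponent \<open>r - 1 - card D\<close>.\<close>
    have "real q \<le> A / (4 * real r)" using A F by (simp add: field_simps)
    then have "A / (4 * real r) \<le> c - real q" by (simp add: c_def field_simps)
    then have "A / (4 * real r) * real n ^ (r - 1 - card D) \<le> (c - real q) * real n ^ (r - 1 - card D)"
      by (intro mult_right_mono) auto
    moreover have "r - card D = Suc (r - 1 - card D)" using cD by simp
    then have "A / (4 * real r * real n) * real n ^ (r - card D) = A / (4 * real r) * real n ^ (r - 1 - card D)"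
      using V F by simp
    ultimately show "A / (4 * real r * real n) * real n ^ (r - card D) \<le> real (card {E' \<in> Gs. D \<subseteq> E' \<and> E' \<inter> W = {}})"
      using ge by linarith
  qed (use fGs uGs \<open>Gs \<noteq> {}\<close> F A in auto)
  also have "\<dots> \<le> real (card (emb H F {} {}))"
    using card_emb_mono[OF Gs fVH fVF] by simp
  finally show ?thesis .
qed

section \<open>Families with a small shadow\<close>

definition shadow :: "'b set set \<Rightarrow> 'b set set" where
  "shadow L = (\<Union>E\<in>L. (\<lambda>v. E - {v}) ` E)"

text \<open>Induction on \<open>r\<close>: every vertex link inherits the degree condition, and
  there are at least \<open>d\<close> vertices. Summing the bounds for the links counts every edge
  \<open>r\<close> times, which builds up the factorial.\<close>

lemma min_shadow_degree_imp_card_ge: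
  fixes d :: real
  assumes "finite L" "uniform r L" "L \<noteq> {}" "d \<ge> 0"
    and "\<And>D. D \<in> shadow L \<Longrightarrow> d \<le> real (card {E \<in> L. D \<subseteq> E})"
  shows "d ^ r \<le> fact r * real (card L)"
  using assms
proof (induction r arbitrary: L)
  case 0
  then have "card L > 0" by (simp add: card_gt_0_iff)
  then show ?case by simp
next
  case (Suc r)
  note fin = Suc.prems(1) and deg = Suc.prems(5)
  have E: "finite E" "card E = Suc r" if "E \<in> L" for E using Suc.prems that by (auto simp: uniform_def)
  have fV: "finite (\<Union>L)" using fin E by auto
  have link: "d ^ r \<le> fact r * real (card {E \<in> L. v \<in> E})" if v: "v \<in> \<Union>L" for v
  proof -
    define M where "M = (\<lambda>E. E - {v}) ` {E \<in> L. v \<in> E}"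
    have inj: "inj_on (\<lambda>E. E - {v}) {E \<in> L. v \<in> E}" by (auto simp: inj_on_def)
    have "d ^ r \<le> fact r * real (card M)"
    proof (rule Suc.IH)
      show "finite M" using fin by (simp add: M_def)
      show "uniform r M" using E by (auto simp: M_def uniform_def)
      show "M \<noteq> {}" using v by (auto simp: M_def)
      fix D assume "D \<in> shadow M"
      then obtain E u where Eu: "E \<in> L" "v \<in> E" "u \<in> E - {v}" "D = E - {v} - {u}"
        by (auto simp: shadow_def M_def)
      \<comment> \<open>Putting \<open>v\<close> back turns a shadow set of the link into a shadow
        set of \<open>L\<close>, and the edges through it correspond to edges of the link through
        \<open>D\<close>.\<close>
      then have "E - {u} \<in> shadow L" "insert v D = E - {u}" by (auto simp: shadow_def)
      then have "d \<le> real (card {E \<in> L. insert v D \<subseteq> E})" using deg by metis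
      also have "card {E \<in> L. insert v D \<subseteq> E} = card ((\<lambda>E. E - {v}) ` {E \<in> L. insert v D \<subseteq> E})"
        by (rule card_image[symmetric]) (rule inj_on_subset[OF inj], auto)
      also have "(\<lambda>E. E - {v}) ` {E \<in> L. insert v D \<subseteq> E} \<subseteq> {E \<in> M. D \<subseteq> E}"
        using Eu by (auto simp: M_def)
      then have "card ((\<lambda>E. E - {v}) ` {E \<in> L. insert v D \<subseteq> E}) \<le> card {E \<in> M. D \<subseteq> E}"
        using fin by (intro card_mono) (auto simp: M_def)
      finally show "d \<le> real (card {E \<in> M. D \<subseteq> E})" by simp
    qed fact
    also have "card M = card {E \<in> L. v \<in> E}" unfolding M_def by (rule card_image[OF inj])
    finally show ?thesis .
  qed
  obtain E0 where E0: "E0 \<in> L" using Suc.prems by auto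
  then have "E0 \<noteq> {}" using E by fastforce
  then obtain v0 where v0: "v0 \<in> E0" by auto
  define D0 where "D0 = E0 - {v0}"
  \<comment> \<open>Edges through a shadow set \<open>D0\<close> differ only in their additional
    vertex, so the degree of \<open>D0\<close> bounds the number of vertices from below.\<close>
  have "{E \<in> L. D0 \<subseteq> E} \<subseteq> (\<lambda>u. insert u D0) ` (\<Union>L)"
  proof
    fix E' assume E': "E' \<in> {E \<in> L. D0 \<subseteq> E}"
    have "card D0 = r" using E[OF E0] v0 by (simp add: D0_def)
    then have "card (E' - D0) = 1" using E' E by (subst card_Diff_subset) (auto simp: D0_def E0 intro: finite_subset)
    then obtain u where "E' - D0 = {u}" by (auto simp: card_1_singleton_iff)
    then have "E' = insert u D0" "u \<in> \<Union>L" using E' by auto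
    then show "E' \<in> (\<lambda>u. insert u D0) ` (\<Union>L)" by blast
  qed
  then have "card {E \<in> L. D0 \<subseteq> E} \<le> card (\<Union>L)" using fV by (rule surj_card_le[rotated])
  moreover have "D0 \<in> shadow L" using E0 v0 by (auto simp: shadow_def D0_def)
  ultimately have "d \<le> real (card (\<Union>L))" using deg by fastforce
  then have "d * d ^ r \<le> real (card (\<Union>L)) * d ^ r" using \<open>d \<ge> 0\<close> by (intro mult_right_mono) auto
  also have "\<dots> = (\<Sum>v\<in>\<Union>L. d ^ r)" by simp
  also have "\<dots> \<le> (\<Sum>v\<in>\<Union>L. fact r * real (card {E \<in> L. v \<in> E}))" using link by (intro sum_mono)
  also have "\<dots> = fact r * (\<Sum>v\<in>\<Union>L. \<Sum>E\<in>L. if v \<in> E then 1 else 0)"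
    using fin by (simp add: sum_distrib_left sum.If_cases Int_def)
  also have "(\<Sum>v\<in>\<Union>L. \<Sum>E\<in>L. if v \<in> E then 1 else 0) = (\<Sum>E\<in>L. \<Sum>v\<in>\<Union>L. if v \<in> E then 1 else (0::real))"
    by (rule sum.swap)
  also have "\<dots> = (\<Sum>E\<in>L. real (Suc r))"
  proof (rule sum.cong)
    fix E' assume E': "E' \<in> L"
    then have "\<Union>L \<inter> {v. v \<in> E'} = E'" by auto
    then show "(\<Sum>v\<in>\<Union>L. if v \<in> E' then 1 else (0::real)) = real (Suc r)"
      using fV E[OF E'] by (simp add: sum.If_cases)
  qed simp
  finally show ?case by (simp add: algebra_simps)
qed

text \<open>Shadow sets of degree below \<open>d\<close> are deleted repeatedly. If nothing
  survives, the loss of at most \<open>d\<close> per shadow set bounds \<open>card L\<close>;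
  otherwise the survivors satisfy the minimum degree condition of the preceding lemma.\<close>

lemma card_le_shadow_or_card_ge:
  fixes d :: real
  assumes "finite L" "uniform r L" "d \<ge> 0"
  shows "real (card L) \<le> d * real (card (shadow L)) \<or> d ^ r \<le> fact r * real (card L)"
proof -
  have fS: "finite (shadow L)" using assms by (auto simp: shadow_def uniform_def)
  obtain Gs where Gs: "Gs \<subseteq> L"
    and good: "\<And>D. D \<in> shadow L \<Longrightarrow> \<exists>E\<in>Gs. D \<subseteq> E \<Longrightarrow> d \<le> real (card {E \<in> Gs. D \<subseteq> E})"
    and lost: "real (card (L - Gs)) \<le> (\<Sum>D\<in>shadow L. d)"
    using min_degree_subfamily[OF assms(1) fS, of "\<lambda>_. d"] assms(3) by auto
  show ?thesis
  proof (cases "Gs = {}")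
    case True
    then show ?thesis using lost by (simp add: mult.commute)
  next
    case False
    have "d ^ r \<le> fact r * real (card Gs)"
    proof (rule min_shadow_degree_imp_card_ge)
      fix D assume D: "D \<in> shadow Gs"
      then have "D \<in> shadow L" "\<exists>E\<in>Gs. D \<subseteq> E" using Gs by (auto simp: shadow_def)
      then show "d \<le> real (card {E \<in> Gs. D \<subseteq> E})" using good by blast
    qed (use assms Gs False in \<open>auto simp: uniform_def finite_subset\<close>)
    also have "\<dots> \<le> fact r * real (card L)"
      using card_mono[OF assms(1) Gs] by (intro mult_left_mono) auto
    finally show ?thesis by simp
  qed
qed

section \<open>Homogeneous subfamilies\<close>

definition cpart :: "('b \<Rightarrow> nat) \<Rightarrow> nat set \<Rightarrow> 'b set \<Rightarrow> 'b set" where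
  "cpart col A E = {v \<in> E. col v \<in> A}"

definition rainbow :: "nat \<Rightarrow> ('b \<Rightarrow> nat) \<Rightarrow> 'b set set \<Rightarrow> bool" where
  "rainbow k col G \<longleftrightarrow> (\<forall>E\<in>G. bij_betw col E {..<k})"

definition determines :: "('b \<Rightarrow> nat) \<Rightarrow> 'b set set \<Rightarrow> nat set \<Rightarrow> nat \<Rightarrow> bool" where
  "determines col G A b \<longleftrightarrow>
     (\<forall>E\<in>G. \<forall>E'\<in>G. cpart col A E = cpart col A E' \<longrightarrow> cpart col {b} E = cpart col {b} E')"

definition closed_cols :: "nat \<Rightarrow> ('b \<Rightarrow> nat) \<Rightarrow> 'b set set \<Rightarrow> nat set set" where
  "closed_cols k col G = {A. A \<subseteq> {..<k} \<and> (\<forall>b<k. determines col G A b \<longrightarrow> b \<in> A)}"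

text \<open>\<open>W\<close> stands for the vertices already used in a partial embedding;
  accordingly \<open>q\<close> is later the number of vertices of \<open>H\<close>.\<close>

definition robust :: "nat \<Rightarrow> real \<Rightarrow> 'b set set \<Rightarrow> 'b set \<Rightarrow> bool" where
  "robust q b G D \<longleftrightarrow> (\<forall>W. finite W \<longrightarrow> card W \<le> q \<longrightarrow> W \<inter> D = {} \<longrightarrow>
     b \<le> real (card {E \<in> G. D \<subseteq> E \<and> E \<inter> W = {}}))"

text \<open>Averaging over all colourings of \<open>V\<close> with \<open>k\<close> colours: a fixed
  edge receives all colours in at least a proportion \<open>1 / k ^ k\<close> of them.\<close>

lemma ex_rainbow_subfamily:
  assumes "finite V" "F \<subseteq> Pow V" "uniform k F" "k > 0"
  shows "\<exists>col. card F \<le> k ^ k * card {E \<in> F. bij_betw col E {..<k}}"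
proof (rule ccontr)
  assume "\<not> ?thesis"
  then have less: "k ^ k * card {E \<in> F. bij_betw c E {..<k}} < card F" for c by (simp add: not_le)
  define C where "C = V \<rightarrow>\<^sub>E {..<k}"
  have fF: "finite F" using assms finite_subset by blast
  have fC: "finite C" and cC: "card C = k ^ card V" using assms by (auto simp: C_def finite_PiE card_PiE)
  have "C \<noteq> {}" using cC \<open>k > 0\<close> by auto
  have each: "k ^ (card V - k) \<le> card {c \<in> C. bij_betw c E {..<k}}" if E: "E \<in> F" for E
  proof -
    have EV: "E \<subseteq> V" "finite E" "card E = k" using assms E by (auto simp: uniform_def)
    then obtain b where b: "bij_betw b E {..<k}"
      using finite_same_card_bij[of E "{..<k}"] by auto
    \<comment> \<open>One fixed bijection \<open>b\<close> colours \<open>E\<close>, the other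
      vertices are coloured freely by \<open>g\<close>; this already gives
      \<open>k ^ (card V - k)\<close> good colourings.\<close>
    define \<phi> where "\<phi> g = (\<lambda>v. if v \<in> E then b v else g v)" for g
    have "inj_on \<phi> ((V - E) \<rightarrow>\<^sub>E {..<k})"
    proof (rule inj_onI)
      fix g h assume gh: "g \<in> (V - E) \<rightarrow>\<^sub>E {..<k}" "h \<in> (V - E) \<rightarrow>\<^sub>E {..<k}" "\<phi> g = \<phi> h"
      show "g = h"
      proof
        fix v
        show "g v = h v"
          using gh(1,2) fun_cong[OF gh(3), of v]
          by (cases "v \<in> E") (auto simp: \<phi>_def PiE_def extensional_def)
      qed
    qed
    moreover have "\<phi> ` ((V - E) \<rightarrow>\<^sub>E {..<k}) \<subseteq> {c \<in> C. bij_betw c E {..<k}}"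
    proof (rule image_subsetI)
      fix g assume g: "g \<in> (V - E) \<rightarrow>\<^sub>E {..<k}"
      have "bij_betw (\<phi> g) E {..<k}" using b by (subst bij_betw_cong[of _ _ b]) (auto simp: \<phi>_def)
      moreover have "\<phi> g \<in> C"
        unfolding C_def
      proof (rule PiE_I)
        fix v assume v: "v \<in> V"
        show "\<phi> g v \<in> {..<k}"
          using v PiE_mem[OF g, of v] bij_betwE[OF b] by (auto simp: \<phi>_def)
      next
        fix v assume "v \<notin> V"
        then show "\<phi> g v = undefined" using PiE_arb[OF g, of v] EV by (auto simp: \<phi>_def)
      qed
      ultimately show "\<phi> g \<in> {c \<in> C. bij_betw c E {..<k}}" by simp
    qed
    ultimately have "card ((V - E) \<rightarrow>\<^sub>E {..<k}) \<le> card {c \<in> C. bij_betw c E {..<k}}"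
      using fC by (intro card_inj_on_le) auto
    moreover have "card ((V - E) \<rightarrow>\<^sub>E {..<k}) = k ^ (card V - k)"
      using EV assms by (simp add: card_PiE card_Diff_subset)
    ultimately show ?thesis by simp
  qed
  have F_ne: "F \<noteq> {}" using less[of undefined] by auto
  then obtain E0 where "E0 \<in> F" by auto
  then have kV: "k \<le> card V" using assms card_mono[of V E0] by (auto simp: uniform_def)
  have "card F * k ^ card V = k ^ k * (\<Sum>E\<in>F. k ^ (card V - k))"
    using kV by (simp flip: power_add)
  also have "\<dots> \<le> k ^ k * (\<Sum>E\<in>F. card {c \<in> C. bij_betw c E {..<k}})"
    using each by (intro mult_left_mono sum_mono) auto
  also have "(\<Sum>E\<in>F. card {c \<in> C. bij_betw c E {..<k}}) = (\<Sum>E\<in>F. \<Sum>c\<in>C. if bij_betw c E {..<k} then 1 else 0)"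
    using fC by (simp add: sum.If_cases Int_def)
  also have "\<dots> = (\<Sum>c\<in>C. \<Sum>E\<in>F. if bij_betw c E {..<k} then 1 else 0)" by (rule sum.swap)
  also have "\<dots> = (\<Sum>c\<in>C. card {E \<in> F. bij_betw c E {..<k}})"
    using fF by (simp add: sum.If_cases Int_def)
  also have "k ^ k * \<dots> = (\<Sum>c\<in>C. k ^ k * card {E \<in> F. bij_betw c E {..<k}})"
    by (rule sum_distrib_left)
  also have "\<dots> < (\<Sum>c\<in>C. card F)" using fC \<open>C \<noteq> {}\<close> less by (intro sum_strict_mono) auto
  finally show False using cC by simp
qed

lemma cpart_eq:
  assumes "rainbow k col G" "E \<in> G" "D \<subseteq> E"
  shows "cpart col (col ` D) E = D"
proof -
  have "inj_on col E" using assms by (auto simp: rainbow_def bij_betw_def)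
  then show ?thesis using assms(3) by (auto simp: cpart_def dest: inj_onD)
qed

lemma image_cpart:
  assumes "rainbow k col G" "E \<in> G" "A \<subseteq> {..<k}"
  shows "col ` cpart col A E = A" "card (cpart col A E) = card A"
proof -
  have b: "bij_betw col E {..<k}" using assms by (auto simp: rainbow_def)
  show *: "col ` cpart col A E = A"
    using b assms(3) by (auto simp: cpart_def bij_betw_def image_iff)
  have "inj_on col (cpart col A E)" using b by (auto simp: cpart_def bij_betw_def intro: inj_on_subset)
  then show "card (cpart col A E) = card A" using * card_image by metis
qed

lemma determines_subset: "G' \<subseteq> G \<Longrightarrow> determines col G A b \<Longrightarrow> determines col G' A b"
  unfolding determines_def by blast

lemma determines_mono:
  assumes "A \<subseteq> A'" "determines col G A b"
  shows "determines col G A' b"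
proof -
  have "cpart col A E = cpart col A E'" if "cpart col A' E = cpart col A' E'" for E E'
    using that assms(1) unfolding cpart_def set_eq_iff by blast
  then show ?thesis using assms(2) unfolding determines_def by blast
qed

text \<open>A colour determined by the intersection is determined by both sets, hence belongs to
  both.\<close>

lemma closed_cols_Int: "A \<in> closed_cols k col G \<Longrightarrow> B \<in> closed_cols k col G \<Longrightarrow> A \<inter> B \<in> closed_cols k col G"
  unfolding closed_cols_def by (auto intro: determines_mono[of "A \<inter> B"])

lemma uniform_rainbow: "rainbow k col G \<Longrightarrow> uniform k G"
  unfolding rainbow_def uniform_def by (metis bij_betw_finite bij_betw_same_card card_lessThan finite_lessThan)

text \<open>Sets with closed colour set that are not robust are deleted. A lost edge through a
  deleted \<open>D\<close> either avoids the witness \<open>W\<close> of failure, and few edges do,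
  or it contains a vertex of \<open>W\<close>. In the second case, fixing the colours
  \<open>A\<close> of \<open>D\<close>, the index of that vertex in \<open>W\<close> and its colour
  \<open>b\<close> gives a subfamily in which \<open>A\<close> determines \<open>b\<close>. This is
  a new determination, because \<open>A\<close> is closed in \<open>G\<close> and \<open>b\<close>
  is outside \<open>A\<close>; so \<open>no\<close> makes each of these boundedly many subfamilies
  small.\<close>

lemma determines_or_robust:
  fixes \<delta> :: real and G :: "'b set set"
  assumes V: "finite V" "card V = n" "n > 0" and G: "G \<subseteq> Pow V" "rainbow k col G" and "k > 0" "\<delta> > 0"
    and large: "\<delta> * real n ^ (k - 1) \<le> real (card G)"
    and \<delta>1: "4 * 2 ^ k * real q * real k * \<delta>1 \<le> \<delta>"
    and no: "\<And>A b G1. A \<subseteq> {..<k} \<Longrightarrow> b < k \<Longrightarrow> \<not> determines col G A b \<Longrightarrow> G1 \<subseteq> G \<Longrightarrow>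
      determines col G1 A b \<Longrightarrow> real (card G1) < \<delta>1 * real n ^ (k - 1)"
  shows "\<exists>Gs \<subseteq> G. \<delta> / 2 * real n ^ (k - 1) \<le> real (card Gs) \<and>
    (\<forall>E\<in>Gs. \<forall>A\<in>closed_cols k col G. A \<noteq> {..<k} \<longrightarrow>
       robust q (\<delta> / (4 * real k) * real n ^ (k - 1 - card A)) Gs (cpart col A E))"
proof -
  \<comment> \<open>Makes the cost of the edges avoiding their witness at most
    \<open>\<delta> / 4 * n ^ (k - 1)\<close>; the subfamilies \<open>Y\<close> may cost as much
    again, leaving half of the lower bound on \<open>card G\<close>.\<close>
  define c where "c = \<delta> / (4 * real k)"
  have c: "c > 0" using assms by (simp add: c_def)
  define \<D> where "\<D> = {D. D \<subseteq> V \<and> card D < k \<and> col ` D \<in> closed_cols k col G}"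
  define bad where "bad G' D \<longleftrightarrow> \<not> robust q (c * real n ^ (k - 1 - card D)) G' D" for G' and D :: "'b set"
  have fG: "finite G" using V G finite_subset by blast
  obtain Gs P \<Gamma> where Gs: "Gs \<subseteq> G" "P \<subseteq> \<D>"
    and good: "\<forall>D\<in>\<D>. (\<exists>E\<in>Gs. D \<subseteq> E) \<longrightarrow> \<not> bad Gs D"
    and lost: "\<forall>D\<in>P. bad (\<Gamma> D) D \<and> \<Gamma> D \<subseteq> G \<and> (\<exists>E\<in>G. D \<subseteq> E)" "G - Gs \<subseteq> (\<Union>D\<in>P. {E \<in> \<Gamma> D. D \<subseteq> E})"
    using cleaning[OF fG, of \<D> bad] by (elim exE conjE) (rule that)
  have f\<D>: "finite \<D>" using V by (auto simp: \<D>_def)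
  then have fP: "finite P" using Gs finite_subset by blast
  have "\<forall>D\<in>P. \<exists>W. finite W \<and> card W \<le> q \<and> W \<inter> D = {} \<and>
      real (card {E \<in> \<Gamma> D. D \<subseteq> E \<and> E \<inter> W = {}}) < c * real n ^ (k - 1 - card D)"
    using lost(1) by (auto simp: bad_def robust_def not_le)
  from bchoice[OF this] obtain Wf where Wf: "\<And>D. D \<in> P \<Longrightarrow> finite (Wf D) \<and> card (Wf D) \<le> q \<and> Wf D \<inter> D = {} \<and>
      real (card {E \<in> \<Gamma> D. D \<subseteq> E \<and> E \<inter> Wf D = {}}) < c * real n ^ (k - 1 - card D)"
    by blast
  have "\<forall>D\<in>P. \<exists>\<omega>. Wf D \<subseteq> \<omega> ` {..<q}"
  proof
    fix D assume D: "D \<in> P"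
    obtain h where "bij_betw h {0..<card (Wf D)} (Wf D)" using ex_bij_betw_nat_finite Wf D by blast
    then have "Wf D = h ` {0..<card (Wf D)}" by (simp add: bij_betw_def)
    also have "\<dots> \<subseteq> h ` {..<q}" using Wf[OF D] by (intro image_mono) auto
    finally show "\<exists>\<omega>. Wf D \<subseteq> \<omega> ` {..<q}" by blast
  qed
  then have "\<exists>\<omega>. \<forall>D\<in>P. Wf D \<subseteq> \<omega> D ` {..<q}" by (rule bchoice)
  then obtain \<omega> where \<omega>: "\<forall>D\<in>P. Wf D \<subseteq> \<omega> D ` {..<q}" by (rule exE)
  define X where "X = (\<Union>D\<in>P. {E \<in> \<Gamma> D. D \<subseteq> E \<and> E \<inter> Wf D = {}})"
  \<comment> \<open>The edges whose vertex of colour \<open>b\<close> is the entry with index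
    \<open>i\<close> in the list attached to their own \<open>A\<close>-part; hence the
    \<open>A\<close>-part determines that vertex.\<close>
  define Y where "Y A i b = {E \<in> G. \<omega> (cpart col A E) i \<in> E \<and> col (\<omega> (cpart col A E) i) = b}" for A i b
  define I where "I = {(A, i, b). A \<in> closed_cols k col G \<and> i < q \<and> b < k \<and> b \<notin> A}"
  have f\<Gamma>: "finite {E \<in> \<Gamma> D. D \<subseteq> E \<and> E \<inter> Wf D = {}}" if "D \<in> P" for D
  proof -
    have "\<Gamma> D \<subseteq> G" using lost(1) that by blast
    then have "finite (\<Gamma> D)" using fG by (rule finite_subset)
    then show ?thesis by simp
  qed
  have "real (card X) \<le> (\<Sum>D\<in>P. real (card {E \<in> \<Gamma> D. D \<subseteq> E \<and> E \<inter> Wf D = {}}))"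
    unfolding X_def using fP by (rule real_card_UN_le)
  also have "\<dots> \<le> (\<Sum>D\<in>P. c * real n ^ (k - 1 - card D))"
    using Wf by (intro sum_mono less_imp_le) blast
  also have "\<dots> \<le> (\<Sum>D | D \<subseteq> V \<and> card D < k. c * real n ^ (k - 1 - card D))"
    using V Gs c by (intro sum_mono2) (auto simp: \<D>_def)
  also have "\<dots> \<le> c * (real k * real n ^ (k - 1))"
    using sum_small_subsets_le[OF V(1,2), of k] c by (simp flip: sum_distrib_left)
  also have "\<dots> = \<delta> / 4 * real n ^ (k - 1)" using \<open>k > 0\<close> by (simp add: c_def)
  finally have cX: "real (card X) \<le> \<delta> / 4 * real n ^ (k - 1)" .
  have IS: "I \<subseteq> Pow {..<k} \<times> {..<q} \<times> {..<k}" by (auto simp: I_def closed_cols_def)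
  then have fI: "finite I" by (rule finite_subset) auto
  have "card I \<le> card (Pow {..<k} \<times> {..<q} \<times> {..<k})" using IS by (intro card_mono) auto
  then have cI: "card I \<le> 2 ^ k * (q * k)" by (simp add: card_Pow)
  have cY: "real (card (Y A i b)) \<le> \<delta>1 * real n ^ (k - 1)" if "(A, i, b) \<in> I" for A i b
  proof (rule less_imp_le, rule no)
    show "A \<subseteq> {..<k}" "b < k" "\<not> determines col G A b" "Y A i b \<subseteq> G"
      using that by (auto simp: I_def Y_def closed_cols_def)
    show "determines col (Y A i b) A b"
      unfolding determines_def
    proof (intro ballI impI)
      fix E E' assume E: "E \<in> Y A i b" "E' \<in> Y A i b" and eq: "cpart col A E = cpart col A E'"
      define w where "w = \<omega> (cpart col A E) i"
      have w: "w \<in> E" "w \<in> E'" "col w = b" using E eq by (auto simp: Y_def w_def)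
      have "E \<in> G" "E' \<in> G" using E by (auto simp: Y_def)
      then show "cpart col {b} E = cpart col {b} E'"
        using cpart_eq[OF G(2), of _ "{w}"] w by simp
    qed
  qed
  have sub: "G - Gs \<subseteq> X \<union> (\<Union>(A, i, b)\<in>I. Y A i b)"
  proof
    fix E assume E: "E \<in> G - Gs"
    then obtain D where D: "D \<in> P" "E \<in> \<Gamma> D" "D \<subseteq> E" using lost(2) by blast
    show "E \<in> X \<union> (\<Union>(A, i, b)\<in>I. Y A i b)"
    proof (cases "E \<inter> Wf D = {}")
      case True
      then show ?thesis using D by (auto simp: X_def)
    next
      case False
      then obtain w where w: "w \<in> E" "w \<in> Wf D" by auto
      then obtain i where i: "i < q" "w = \<omega> D i" using bspec[OF \<omega> D(1)] by auto
      have b: "bij_betw col E {..<k}" using E G by (auto simp: rainbow_def)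
      have "w \<notin> D" using w Wf[OF D(1)] by auto
      have eqD: "cpart col (col ` D) E = D" using cpart_eq[OF G(2)] E D by blast
      then have "col w \<notin> col ` D" using \<open>w \<notin> D\<close> w by (auto simp: cpart_def)
      moreover have "col w < k" using b w by (auto simp: bij_betw_def)
      moreover have "col ` D \<in> closed_cols k col G" using D Gs by (auto simp: \<D>_def)
      ultimately have "(col ` D, i, col w) \<in> I" using i by (auto simp: I_def)
      moreover have "E \<in> Y (col ` D) i (col w)" using E eqD w i by (auto simp: Y_def)
      ultimately show ?thesis by blast
    qed
  qed
  have fX: "finite X" using fP f\<Gamma> by (simp add: X_def)
  have fY: "finite (\<Union>(A, i, b)\<in>I. Y A i b)" using fG by (rule finite_subset[rotated]) (auto simp: Y_def)
  have "real (card (\<Union>(A, i, b)\<in>I. Y A i b)) \<le> (\<Sum>(A, i, b)\<in>I. real (card (Y A i b)))"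
    using real_card_UN_le[OF fI, of "\<lambda>(A, i, b). Y A i b"] by (simp add: case_prod_unfold)
  also have "\<dots> \<le> (\<Sum>(A, i, b)\<in>I. \<delta>1 * real n ^ (k - 1))"
    using cY by (intro sum_mono) auto
  also have "\<dots> = real (card I) * (\<delta>1 * real n ^ (k - 1))" by simp
  finally have cY': "real (card (\<Union>(A, i, b)\<in>I. Y A i b)) \<le> real (card I) * (\<delta>1 * real n ^ (k - 1))" .
  have "real (card I) * (\<delta>1 * real n ^ (k - 1)) \<le> \<delta> / 4 * real n ^ (k - 1)"
  proof (cases "I = {}")
    case False
    then obtain A i b where "(A, i, b) \<in> I" by auto
    \<comment> \<open>Nonnegativity follows because the quantity bounds the cardinality of some
      \<open>Y\<close>; it allows \<open>card I\<close> to be replaced by its upper bound.\<close>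
    then have "0 \<le> \<delta>1 * real n ^ (k - 1)" using cY by (meson of_nat_0_le_iff order_trans)
    then have "real (card I) * (\<delta>1 * real n ^ (k - 1)) \<le> real (2 ^ k * (q * k)) * (\<delta>1 * real n ^ (k - 1))"
      using cI by (intro mult_right_mono) linarith+
    also have "\<dots> = (4 * 2 ^ k * real q * real k * \<delta>1) / 4 * real n ^ (k - 1)" by simp
    also have "\<dots> \<le> \<delta> / 4 * real n ^ (k - 1)" using \<delta>1 by (intro mult_right_mono divide_right_mono) auto
    finally show ?thesis .
  qed (use \<open>\<delta> > 0\<close> in auto)
  moreover have "card (G - Gs) \<le> card X + card (\<Union>(A, i, b)\<in>I. Y A i b)"
    using card_mono[OF _ sub] fX fY card_Un_le order_trans by blast
  ultimately have "real (card (G - Gs)) \<le> \<delta> / 2 * real n ^ (k - 1)"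
    using cX cY' by (simp add: field_simps)
  moreover have "card (G - Gs) = card G - card Gs" "card Gs \<le> card G"
    using Gs fG by (auto simp: card_Diff_subset finite_subset card_mono)
  ultimately have big: "\<delta> / 2 * real n ^ (k - 1) \<le> real (card Gs)" using large by simp
  have "robust q (c * real n ^ (k - 1 - card A)) Gs (cpart col A E)"
    if E: "E \<in> Gs" and A: "A \<in> closed_cols k col G" "A \<noteq> {..<k}" for E A
  proof -
    have Ak: "A \<subseteq> {..<k}" using A by (auto simp: closed_cols_def)
    have EG: "E \<in> G" using E Gs by auto
    have "card A < k" using Ak A psubset_card_mono[of "{..<k}" A] by auto
    moreover note image_cpart[OF G(2) EG Ak]
    moreover have "cpart col A E \<subseteq> E" by (auto simp: cpart_def)
    ultimately have "cpart col A E \<in> \<D>" using A EG G by (auto simp: \<D>_def)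
    moreover have "\<exists>E\<in>Gs. cpart col A E \<subseteq> E" using E by (auto simp: cpart_def)
    ultimately have "\<not> bad Gs (cpart col A E)"
      using good E \<open>cpart col A E \<subseteq> E\<close> by blast
    then show ?thesis
      using image_cpart(2)[OF G(2) EG Ak] by (simp add: bad_def)
  qed
  then show ?thesis using Gs big unfolding c_def by blast
qed

text \<open>
  Determinations survive passing to subfamilies, so a subfamily with a new determination can be taken
  only boundedly often.
\<close>

lemma homogeneous_subfamily:
  fixes \<delta> :: real
  assumes "k > 0" "\<delta> > 0"
  shows "\<exists>\<delta>'>0. \<exists>c>0. \<forall>(V::'b set) n G col. finite V \<longrightarrow> card V = n \<longrightarrow> n > 0 \<longrightarrow> G \<subseteq> Pow V \<longrightarrow>
    rainbow k col G \<longrightarrow> \<delta> * real n ^ (k - 1) \<le> real (card G) \<longrightarrow>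
    (\<exists>Gs \<subseteq> G. \<delta>' * real n ^ (k - 1) \<le> real (card Gs) \<and>
      (\<forall>E\<in>Gs. \<forall>A\<in>closed_cols k col Gs. A \<noteq> {..<k} \<longrightarrow>
         robust q (c * real n ^ (k - 1 - card A)) Gs (cpart col A E)))"
proof -
  \<comment> \<open>The pairs not yet determined. Their number is the induction measure: it drops on
    passing to a subfamily with a new determination.\<close>
  define U where "U col G = {(A, b). A \<subseteq> {..<k} \<and> b < k \<and> \<not> determines col G A b}"
    for col :: "'b \<Rightarrow> nat" and G
  have fU: "finite (U col G)" for col G
    by (rule finite_subset[of _ "Pow {..<k} \<times> {..<k}"]) (auto simp: U_def)
  have cU: "card (U col G) < Suc (2 ^ k * k)" for col G
  proof -
    have "card (U col G) \<le> card (Pow {..<k} \<times> {..<k})" by (rule card_mono) (auto simp: U_def)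
    then show ?thesis by (simp add: card_Pow)
  qed
  have "\<exists>\<delta>'>0. \<exists>c>0. \<forall>(V::'b set) n G col. finite V \<longrightarrow> card V = n \<longrightarrow> n > 0 \<longrightarrow> G \<subseteq> Pow V \<longrightarrow>
    rainbow k col G \<longrightarrow> \<delta> * real n ^ (k - 1) \<le> real (card G) \<longrightarrow> card (U col G) < m \<longrightarrow>
    (\<exists>Gs \<subseteq> G. \<delta>' * real n ^ (k - 1) \<le> real (card Gs) \<and>
      (\<forall>E\<in>Gs. \<forall>A\<in>closed_cols k col Gs. A \<noteq> {..<k} \<longrightarrow>
         robust q (c * real n ^ (k - 1 - card A)) Gs (cpart col A E)))" for m
    using \<open>\<delta> > 0\<close>
  proof (induction m arbitrary: \<delta>)
    case 0
    show ?case by (rule exI[of _ 1], simp, rule exI[of _ 1], simp)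
  next
    case (Suc m)
    \<comment> \<open>Fits the hypothesis of \<open>determines_or_robust\<close>;
      \<open>Suc q\<close> avoids a division by zero when \<open>q = 0\<close>.\<close>
    define \<delta>1 where "\<delta>1 = \<delta> / (4 * 2 ^ k * real (Suc q) * real k)"
    have \<delta>1: "\<delta>1 > 0" "4 * 2 ^ k * real (Suc q) * real k * \<delta>1 = \<delta>"
      using Suc.prems \<open>k > 0\<close> by (simp_all add: \<delta>1_def)
    have \<delta>1': "4 * 2 ^ k * real q * real k * \<delta>1 \<le> \<delta>"
    proof -
      have "4 * 2 ^ k * real q * real k * \<delta>1 \<le> 4 * 2 ^ k * real (Suc q) * real k * \<delta>1"
        using \<delta>1(1) by (intro mult_right_mono mult_left_mono) auto
      then show ?thesis by (simp only: \<delta>1(2))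
    qed
    from Suc.IH[OF \<delta>1(1)] obtain \<delta>' c where IH: "\<delta>' > 0" "c > 0"
      "\<And>(V::'b set) n G col. finite V \<Longrightarrow> card V = n \<Longrightarrow> n > 0 \<Longrightarrow> G \<subseteq> Pow V \<Longrightarrow>
        rainbow k col G \<Longrightarrow> \<delta>1 * real n ^ (k - 1) \<le> real (card G) \<Longrightarrow> card (U col G) < m \<Longrightarrow>
        (\<exists>Gs \<subseteq> G. \<delta>' * real n ^ (k - 1) \<le> real (card Gs) \<and>
          (\<forall>E\<in>Gs. \<forall>A\<in>closed_cols k col Gs. A \<noteq> {..<k} \<longrightarrow>
             robust q (c * real n ^ (k - 1 - card A)) Gs (cpart col A E)))"
      by (elim exE conjE) blast
    define \<delta>'' where "\<delta>'' = min \<delta>' (\<delta> / 2)"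
    define c' where "c' = min c (\<delta> / (4 * real k))"
    have pos: "\<delta>'' > 0" "c' > 0" using IH Suc.prems \<open>k > 0\<close> by (auto simp: \<delta>''_def c'_def)
    have weaken: "robust q (c' * x) Gs D" if "robust q (d * x) Gs D" "c' \<le> d" "x \<ge> 0"
      for d x and Gs and D :: "'b set"
      using that mult_right_mono[of c' d x] unfolding robust_def by force
    have "\<exists>Gs \<subseteq> G. \<delta>'' * real n ^ (k - 1) \<le> real (card Gs) \<and>
      (\<forall>E\<in>Gs. \<forall>A\<in>closed_cols k col Gs. A \<noteq> {..<k} \<longrightarrow>
         robust q (c' * real n ^ (k - 1 - card A)) Gs (cpart col A E))"
      if V: "finite V" "card V = n" "n > 0" and G: "G \<subseteq> Pow V" "rainbow k col G"
        and large: "\<delta> * real n ^ (k - 1) \<le> real (card G)" and meas: "card (U col G) < Suc m"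
      for V :: "'b set" and n G col
    proof (cases "\<exists>A b G1. A \<subseteq> {..<k} \<and> b < k \<and> \<not> determines col G A b \<and> G1 \<subseteq> G \<and>
        determines col G1 A b \<and> \<delta>1 * real n ^ (k - 1) \<le> real (card G1)")
      case True
      then obtain A b G1 where G1: "A \<subseteq> {..<k}" "b < k" "\<not> determines col G A b" "G1 \<subseteq> G"
        "determines col G1 A b" "\<delta>1 * real n ^ (k - 1) \<le> real (card G1)" by blast
      \<comment> \<open>All old determinations persist in \<open>G1\<close>, and the pair
        \<open>(A, b)\<close> is a new one, so the induction hypothesis applies to
        \<open>G1\<close>.\<close>
      have "U col G1 \<subset> U col G"
      proof
        show "U col G1 \<subseteq> U col G" using determines_subset[OF G1(4)] by (auto simp: U_def)
        have "(A, b) \<in> U col G" "(A, b) \<notin> U col G1" using G1 by (auto simp: U_def)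
        then show "U col G1 \<noteq> U col G" by blast
      qed
      then have "card (U col G1) < card (U col G)" by (rule psubset_card_mono[OF fU])
      then have cm: "card (U col G1) < m" using meas by simp
      have G1': "G1 \<subseteq> Pow V" "rainbow k col G1" using G G1 by (auto simp: rainbow_def)
      obtain Gs where Gs: "Gs \<subseteq> G1" "\<delta>' * real n ^ (k - 1) \<le> real (card Gs)"
        "\<forall>E\<in>Gs. \<forall>A\<in>closed_cols k col Gs. A \<noteq> {..<k} \<longrightarrow>
             robust q (c * real n ^ (k - 1 - card A)) Gs (cpart col A E)"
        using IH(3)[OF V G1' G1(6) cm] by (elim exE conjE) (rule that)
      have "\<delta>'' * real n ^ (k - 1) \<le> \<delta>' * real n ^ (k - 1)"
        by (intro mult_right_mono) (auto simp: \<delta>''_def)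
      moreover have "c' \<le> c" by (simp add: c'_def)
      moreover have "robust q (c' * real n ^ (k - 1 - card A)) Gs (cpart col A E)"
        if "E \<in> Gs" "A \<in> closed_cols k col Gs" "A \<noteq> {..<k}" for E A
        using Gs(3) that \<open>c' \<le> c\<close> by (intro weaken[of c]) auto
      moreover have "Gs \<subseteq> G" using Gs(1) G1(4) by (rule order_trans)
      ultimately show ?thesis
        using Gs(2) by (intro exI[of _ Gs] conjI ballI impI) (assumption | linarith | simp)+
    next
      case False
      then have no: "\<And>A b G1. A \<subseteq> {..<k} \<Longrightarrow> b < k \<Longrightarrow> \<not> determines col G A b \<Longrightarrow> G1 \<subseteq> G \<Longrightarrow>
        determines col G1 A b \<Longrightarrow> real (card G1) < \<delta>1 * real n ^ (k - 1)"
        by (meson not_le)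
      have "\<exists>Gs \<subseteq> G. \<delta> / 2 * real n ^ (k - 1) \<le> real (card Gs) \<and>
        (\<forall>E\<in>Gs. \<forall>A\<in>closed_cols k col G. A \<noteq> {..<k} \<longrightarrow>
            robust q (\<delta> / (4 * real k) * real n ^ (k - 1 - card A)) Gs (cpart col A E))"
        by (rule determines_or_robust[OF V G \<open>k > 0\<close> Suc.prems large \<delta>1']) (rule no)
      then obtain Gs where Gs: "Gs \<subseteq> G" "\<delta> / 2 * real n ^ (k - 1) \<le> real (card Gs)"
        "\<forall>E\<in>Gs. \<forall>A\<in>closed_cols k col G. A \<noteq> {..<k} \<longrightarrow>
            robust q (\<delta> / (4 * real k) * real n ^ (k - 1 - card A)) Gs (cpart col A E)"
        by (elim exE conjE) (rule that)
      \<comment> \<open>Robustness is known for the colour sets closed in \<open>G\<close>. Since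
        \<open>Gs\<close> has at least the determinations of \<open>G\<close>, a set closed in
        \<open>Gs\<close> is also closed in \<open>G\<close>.\<close>
      have cc: "closed_cols k col Gs \<subseteq> closed_cols k col G"
        using determines_subset[OF Gs(1)] by (auto simp: closed_cols_def)
      have "\<delta>'' * real n ^ (k - 1) \<le> \<delta> / 2 * real n ^ (k - 1)"
        by (intro mult_right_mono) (auto simp: \<delta>''_def)
      moreover have "c' \<le> \<delta> / (4 * real k)" by (simp add: c'_def)
      moreover have "robust q (c' * real n ^ (k - 1 - card A)) Gs (cpart col A E)"
        if "E \<in> Gs" "A \<in> closed_cols k col Gs" "A \<noteq> {..<k}" for E A
        using Gs(3) that cc \<open>c' \<le> \<delta> / (4 * real k)\<close> by (intro weaken[of "\<delta> / (4 * real k)"]) auto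
      ultimately show ?thesis
        using Gs(1,2) by (intro exI[of _ Gs] conjI ballI impI) (assumption | linarith | simp)+
    qed
    then show ?case by (intro exI[of _ \<delta>''] exI[of _ c'] conjI allI impI pos)
  qed
  \<comment> \<open>There are at most \<open>2 ^ k * k\<close> pairs in all, so at this
    \<open>m\<close> the bound on the measure always holds.\<close>
  from this[of "Suc (2 ^ k * k)"] show ?thesis using cU by simp
qed

section \<open>Robust colour sets or a vertex of high degree\<close>

lemma rainbow_eqI:
  assumes "rainbow k col G" "E \<in> G" "E' \<in> G" "\<And>b. b < k \<Longrightarrow> cpart col {b} E = cpart col {b} E'"
  shows "E = E'"
proof -
  have "E = (\<Union>b<k. cpart col {b} E)" if "E \<in> G" for E
    using assms(1) that by (auto simp: rainbow_def cpart_def bij_betw_def)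
  then show ?thesis using assms(2-4) by (metis (no_types, lifting) SUP_cong lessThan_iff)
qed

text \<open>The colours other than \<open>x\<close> and \<open>y\<close> fix the vertex of colour
  \<open>y\<close>, and together with it that of colour \<open>x\<close>. An edge is thus recovered
  from \<open>k - 2\<close> of its vertices.\<close>

lemma determines_both_imp_card_le:
  assumes V: "finite V" "card V = n" and G: "G \<subseteq> Pow V" "rainbow k col G"
    and xy: "x < k" "y < k" "x \<noteq> y"
    and det: "determines col G ({..<k} - {x, y}) y" "determines col G ({..<k} - {x}) x"
  shows "card G \<le> n ^ (k - 2)"
proof -
  let ?A = "{..<k} - {x, y}"
  have cA: "card ?A = k - 2" using xy by (simp add: card_Diff_subset)
  have "inj_on (cpart col ?A) G"
  proof (rule inj_onI)
    fix E E' assume E: "E \<in> G" "E' \<in> G" and eq: "cpart col ?A E = cpart col ?A E'"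
    have y: "cpart col {y} E = cpart col {y} E'" using det(1) E eq unfolding determines_def by blast
    have split: "cpart col ({..<k} - {x}) E = cpart col ?A E \<union> cpart col {y} E" for E
      using xy by (auto simp: cpart_def)
    have x: "cpart col {x} E = cpart col {x} E'"
      using det(2) E eq y split unfolding determines_def by metis
    show "E = E'"
    proof (rule rainbow_eqI[OF G(2) E])
      fix b assume "b < k"
      have sub: "cpart col {b} E = cpart col {b} (cpart col ?A E)" if "b \<noteq> x" "b \<noteq> y" for E
        using that \<open>b < k\<close> by (auto simp: cpart_def)
      show "cpart col {b} E = cpart col {b} E'"
        using x y sub[of E] sub[of E'] eq by metis
    qed
  qed
  moreover have "cpart col ?A ` G \<subseteq> {D. D \<subseteq> V \<and> card D = k - 2}"
  proof (rule image_subsetI)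
    fix E assume E: "E \<in> G"
    have "cpart col ?A E \<subseteq> V" using E G by (auto simp: cpart_def)
    then show "cpart col ?A E \<in> {D. D \<subseteq> V \<and> card D = k - 2}"
      using image_cpart(2)[OF G(2) E, of ?A] cA by auto
  qed
  ultimately have "card G \<le> card {D. D \<subseteq> V \<and> card D = k - 2}"
    using V by (intro card_inj_on_le) auto
  also have "\<dots> = n choose (k - 2)" using V by (simp add: n_subsets)
  also have "\<dots> \<le> n ^ (k - 2)"
    by (cases "k - 2 \<le> n") (auto simp: binomial_le_pow binomial_eq_0)
  finally show ?thesis .
qed

text \<open>If the complement of every colour is closed, intersections make every set of colours
  closed. Otherwise the complement of some \<open>x\<close> determines \<open>x\<close>. Then, since
  \<open>G\<close> is too large for \<open>k - 2\<close> vertices to fix an edge, omitting a further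
  colour \<open>y\<close> leaves a set that is closed or determines \<open>x\<close>. One closed set
  of this kind gives the first case, none the second.\<close>

lemma closed_cols_cases:
  assumes V: "finite V" "card V = n" and G: "G \<subseteq> Pow V" "rainbow k col G" and "k \<ge> 2"
    and large: "n ^ (k - 2) < card G"
  obtains x y where "x < k" "y < k" "x \<noteq> y" "\<And>A. A \<subseteq> {..<k} - {x, y} \<Longrightarrow> A \<in> closed_cols k col G"
  | x where "x < k" "\<And>y. y < k \<Longrightarrow> y \<noteq> x \<Longrightarrow> determines col G ({..<k} - {x, y}) x"
proof -
  define J where "J = closed_cols k col G"
  define co where "co x = {..<k} - {x}" for x
  define co2 where "co2 x y = {..<k} - {x, y}" for x y
  have sym: "co2 x y = co2 y x" for x y by (auto simp: co2_def)
  have Int: "A \<inter> B \<in> J" if "A \<in> J" "B \<in> J" for A B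
    using that closed_cols_Int unfolding J_def by blast
  \<comment> \<open>If \<open>co x\<close> is not closed it determines \<open>x\<close>, the only
    colour outside it; a determination of \<open>y\<close> by \<open>co2 x y\<close> would then
    violate the size of \<open>G\<close>.\<close>
  have rank: "\<not> determines col G (co2 x y) y" if xJ: "co x \<notin> J" and xy: "x < k" "y < k" "x \<noteq> y" for x y
  proof
    assume det: "determines col G (co2 x y) y"
    obtain b where "b < k" "determines col G (co x) b" "b \<notin> co x"
      using xJ unfolding J_def closed_cols_def co_def by blast
    then have "determines col G (co x) x" by (auto simp: co_def)
    then have "card G \<le> n ^ (k - 2)"
      using determines_both_imp_card_le[OF V G xy] det unfolding co_def co2_def by blast
    then show False using large by simp
  qed
  have co2J: "determines col G (co2 x y) x \<or> determines col G (co2 x y) y" if "co2 x y \<notin> J" for x y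
    using that unfolding J_def closed_cols_def co2_def by blast
  \<comment> \<open>Every subset of \<open>co2 x y\<close> arises by removing colours
    \<open>z\<close> one at a time, each by intersecting with \<open>co z\<close> or
    \<open>co2 x z\<close>, whichever is closed.\<close>
  have down: "A \<in> J" if xy: "co2 x y \<in> J" and z: "\<And>z. z < k \<Longrightarrow> z \<noteq> x \<Longrightarrow> z \<noteq> y \<Longrightarrow> co z \<in> J \<or> co2 x z \<in> J"
    and A: "A \<subseteq> co2 x y" for x y A
  proof -
    have "co2 x y - B \<in> J" if "finite B" "B \<subseteq> co2 x y" for B
      using that
    proof (induction rule: finite_induct)
      case empty
      then show ?case using xy by simp
    next
      case (insert z B)
      then have IH: "co2 x y - B \<in> J" and z': "z < k" "z \<noteq> x" "z \<noteq> y" by (auto simp: co2_def)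
      have "co2 x y - insert z B = (co2 x y - B) \<inter> co z" "co2 x y - insert z B = (co2 x y - B) \<inter> co2 x z"
        by (auto simp: co_def co2_def)
      then show ?case using z[OF z'] Int[OF IH] by metis
    qed
    from this[of "co2 x y - A"] have "co2 x y - (co2 x y - A) \<in> J" by (auto simp: co2_def)
    then show ?thesis using A by (simp add: double_diff)
  qed
  show thesis
  proof (cases "\<exists>x<k. co x \<notin> J")
    case True
    then obtain x where x: "x < k" "co x \<notin> J" by blast
    show thesis
    proof (cases "\<exists>y<k. y \<noteq> x \<and> co2 x y \<in> J")
      case True
      then obtain y where y: "y < k" "y \<noteq> x" "co2 x y \<in> J" by blast
      \<comment> \<open>If neither \<open>co x\<close> nor \<open>co z\<close> is closed,
        \<open>rank\<close> in both directions shows that \<open>co2 x z\<close> determines neither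
        \<open>x\<close> nor \<open>z\<close>, so it is closed.\<close>
      have "co z \<in> J \<or> co2 x z \<in> J" if "z < k" "z \<noteq> x" for z
        using rank[OF x(2,1), of z] rank[of z x] co2J[of x z] sym[of z x] that x by metis
      then have "A \<in> J" if "A \<subseteq> co2 x y" for A using down[OF y(3)] that by blast
      then show thesis using that(1)[OF x(1) y(1)] y by (auto simp: J_def co2_def)
    next
      case False
      have "determines col G (co2 x y) x" if "y < k" "y \<noteq> x" for y
        using False rank[OF x(2,1), of y] co2J[of x y] that by blast
      then show thesis using that(2)[OF x(1)] by (simp add: co2_def)
    qed
  next
    case False
    then have co: "co x \<in> J" if "x < k" for x using that by blast
    have "co2 0 1 = co 0 \<inter> co 1" by (auto simp: co_def co2_def)
    then have "co2 0 1 \<in> J" using Int co \<open>k \<ge> 2\<close> by simp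
    then have "A \<in> J" if "A \<subseteq> co2 0 1" for A using down that co by blast
    then show thesis using that(1)[of 0 1] \<open>k \<ge> 2\<close> by (auto simp: J_def co2_def)
  qed
qed

text \<open>\<open>Z\<close> collects two chosen degree-1 vertices of each edge. Such a vertex lies
  in no other edge, so the choices do not interfere.\<close>

lemma two_contractible_private:
  assumes "finite H" "uniform k H" "two_contractible H"
  shows "\<exists>Z \<subseteq> hverts H. (\<forall>E\<in>H. card (E \<inter> Z) = 2) \<and>
    (\<forall>E\<in>H. \<forall>F\<in>H. E \<noteq> F \<longrightarrow> E \<inter> F \<inter> Z = {})"
proof -
  have "\<forall>E\<in>H. \<exists>P. P \<subseteq> {v \<in> E. hdegree H v = 1} \<and> card P = 2"
    using assms(3) unfolding two_contractible_def by (meson obtain_subset_with_card_n)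
  then have "\<exists>P. \<forall>E\<in>H. P E \<subseteq> {v \<in> E. hdegree H v = 1} \<and> card (P E) = 2" by (rule bchoice)
  then obtain P where P: "\<And>E. E \<in> H \<Longrightarrow> P E \<subseteq> {v \<in> E. hdegree H v = 1}" "\<And>E. E \<in> H \<Longrightarrow> card (P E) = 2"
    by blast
  have uniq: "E = F" if "E \<in> H" "F \<in> H" "v \<in> E" "v \<in> F" and dv: "hdegree H v = 1" for E F v
  proof -
    obtain E0 where "{E \<in> H. v \<in> E} = {E0}" using dv by (auto simp: hdegree_def card_1_singleton_iff)
    then have "E = E0" "F = E0" using that by blast+
    then show "E = F" by simp
  qed
  define Z where "Z = (\<Union>E\<in>H. P E)"
  have deg: "hdegree H v = 1" if "v \<in> Z" for v using that P(1) by (auto simp: Z_def)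
  have EZ: "E \<inter> Z = P E" if E: "E \<in> H" for E
  proof
    show "P E \<subseteq> E \<inter> Z" using P(1)[OF E] E by (auto simp: Z_def)
    show "E \<inter> Z \<subseteq> P E"
    proof
      fix v assume v: "v \<in> E \<inter> Z"
      then obtain F where F: "F \<in> H" "v \<in> P F" by (auto simp: Z_def)
      then have "v \<in> F" using P(1) by blast
      then have "E = F" using uniq[OF E F(1)] v deg by blast
      then show "v \<in> P E" using F by simp
    qed
  qed
  have "Z \<subseteq> hverts H" using P(1) by (fastforce simp: Z_def hverts_def)
  moreover have "card (E \<inter> Z) = 2" if "E \<in> H" for E using EZ[OF that] P(2)[OF that] by simp
  moreover have "E \<inter> F \<inter> Z = {}" if "E \<in> H" "F \<in> H" "E \<noteq> F" for E F
    using uniq[OF that(1,2)] that(3) deg by blast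
  ultimately show ?thesis by (intro exI[of _ Z] conjI ballI impI)
qed

text \<open>A \<open>(k - 2)\<close>-set of colours other than \<open>x\<close> determines the
  vertex of colour \<open>x\<close>, so the links of the vertices of colour \<open>x\<close> have
  disjoint shadows, of total size at most \<open>n ^ (k - 2)\<close>. If all degrees were small,
  each link would be at most \<open>d\<close> times its shadow, and \<open>G\<close> would be too
  small.\<close>

lemma determined_color_imp_high_degree:
  fixes \<delta>' :: real
  assumes V: "finite V" "card V = n" "n > 0" and G: "G \<subseteq> Pow V" "rainbow k col G" and "k \<ge> 2" and \<delta>': "\<delta>' > 0"
    and large: "\<delta>' * real n ^ (k - 1) \<le> real (card G)"
    and x: "x < k" and det: "\<And>y. y < k \<Longrightarrow> y \<noteq> x \<Longrightarrow> determines col G ({..<k} - {x, y}) x"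
  shows "\<exists>v. (\<delta>' / 2) ^ (k - 1) / fact (k - 1) * real n ^ (k - 1) \<le> real (hdegree G v)"
proof (rule ccontr)
  assume "\<not> ?thesis"
  then have small: "real (hdegree G v) < (\<delta>' / 2) ^ (k - 1) / fact (k - 1) * real n ^ (k - 1)" for v
    by (auto simp: not_le)
  \<comment> \<open>Chosen so that \<open>d * n ^ (k - 2)\<close> is half of the lower bound on
    \<open>card G\<close>, while \<open>d ^ (k - 1) / fact (k - 1)\<close> is the degree bound to be
    contradicted.\<close>
  define d where "d = \<delta>' / 2 * real n"
  have d: "d > 0" using V \<delta>' by (simp add: d_def)
  define Vx where "Vx = {v \<in> V. col v = x}"
  define L where "L v = (\<lambda>E. E - {v}) ` {E \<in> G. v \<in> E}" for v
  have fG: "finite G" using V G finite_subset by blast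
  have uG: "uniform k G" using G uniform_rainbow by blast
  have fE: "finite E" "card E = k" if "E \<in> G" for E using uG that by (auto simp: uniform_def)
  have uL: "uniform (k - 1) (L v)" for v using fE by (auto simp: L_def uniform_def)
  have fL: "finite (L v)" for v using fG by (simp add: L_def)
  have "inj_on (\<lambda>E. E - {v}) {E \<in> G. v \<in> E}" for v by (auto simp: inj_on_def)
  then have cL: "card (L v) = hdegree G v" for v by (simp add: L_def hdegree_def card_image)
  have L_le: "real (card (L v)) \<le> d * real (card (shadow (L v)))" for v
  proof -
    have "\<not> d ^ (k - 1) \<le> fact (k - 1) * real (card (L v))"
      using small[of v] by (simp add: cL d_def field_simps power_mult_distrib)
    then show ?thesis using card_le_shadow_or_card_ge[OF fL uL, of d v] d by auto
  qed
  have shadowE: "\<exists>E\<in>G. \<exists>u\<in>E. v \<in> E \<and> u \<noteq> v \<and> D = E - {v, u}" if "D \<in> shadow (L v)" for D v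
    using that by (auto simp: shadow_def L_def)
  have colD: "col ` (E - {v, u}) = {..<k} - {x, col u}" "col u < k" "col u \<noteq> x"
    if "E \<in> G" "v \<in> E" "u \<in> E" "u \<noteq> v" "col v = x" for E u v
  proof -
    have b: "inj_on col E" "col ` E = {..<k}" using G that by (auto simp: rainbow_def bij_betw_def)
    have "col ` (E - {v, u}) = col ` E - col ` {v, u}" using b that by (intro inj_on_image_set_diff) auto
    then show "col ` (E - {v, u}) = {..<k} - {x, col u}" using b that by simp
    show "col u < k" using b that by blast
    show "col u \<noteq> x" using b that by (metis inj_onD)
  qed
  \<comment> \<open>A common shadow set \<open>D\<close> misses, besides \<open>x\<close>, the same
    further colour in both edges, since that colour can be read off from the colours of
    \<open>D\<close>; so one determination applies to both edges.\<close>
  have disj: "shadow (L v) \<inter> shadow (L v') = {}" if v: "v \<in> Vx" "v' \<in> Vx" "v \<noteq> v'" for v v'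
  proof (rule ccontr)
    assume "shadow (L v) \<inter> shadow (L v') \<noteq> {}"
    then obtain D where D: "D \<in> shadow (L v)" "D \<in> shadow (L v')" by auto
    obtain E u where E: "E \<in> G" "u \<in> E" "v \<in> E" "u \<noteq> v" "D = E - {v, u}" using shadowE[OF D(1)] by blast
    obtain E' u' where E': "E' \<in> G" "u' \<in> E'" "v' \<in> E'" "u' \<noteq> v'" "D = E' - {v', u'}" using shadowE[OF D(2)] by blast
    have cv: "col v = x" "col v' = x" using v by (auto simp: Vx_def)
    let ?A = "{..<k} - {x, col u}"
    have colD': "col ` D = ?A" "col u < k" "col u \<noteq> x" using colD[OF E(1,3,2,4)] cv E(5) by auto
    have "cpart col ?A E = D" "cpart col ?A E' = D"
      using cpart_eq[OF G(2), of _ D] E E' colD'(1) by auto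
    then have "cpart col {x} E = cpart col {x} E'"
      using det[OF colD'(2,3)] E(1) E'(1) unfolding determines_def by metis
    moreover have "cpart col {x} E = {v}" "cpart col {x} E' = {v'}"
      using cpart_eq[OF G(2) E(1), of "{v}"] cpart_eq[OF G(2) E'(1), of "{v'}"] E E' cv by auto
    ultimately show False using v by simp
  qed
  have fVx: "finite Vx" using V by (simp add: Vx_def)
  have fS: "finite (shadow (L v))" for v
    using fL uL by (auto simp: shadow_def uniform_def)
  have "(\<Union>v\<in>Vx. shadow (L v)) \<subseteq> {D. D \<subseteq> V \<and> card D = k - 2}"
  proof
    fix D assume "D \<in> (\<Union>v\<in>Vx. shadow (L v))"
    then obtain v E u where E: "E \<in> G" "u \<in> E" "v \<in> E" "u \<noteq> v" "D = E - {v, u}" using shadowE by blast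
    then have "card D = k - 2" using fE[OF E(1)] by (simp add: card_Diff_subset)
    then show "D \<in> {D. D \<subseteq> V \<and> card D = k - 2}" using E G by auto
  qed
  then have "card (\<Union>v\<in>Vx. shadow (L v)) \<le> card {D. D \<subseteq> V \<and> card D = k - 2}"
    using V by (intro card_mono) auto
  also have "\<dots> = n choose (k - 2)" using V by (simp add: n_subsets)
  also have "\<dots> \<le> n ^ (k - 2)"
    by (cases "k - 2 \<le> n") (auto simp: binomial_le_pow binomial_eq_0)
  finally have "card (\<Union>v\<in>Vx. shadow (L v)) \<le> n ^ (k - 2)" .
  moreover have "card (\<Union>v\<in>Vx. shadow (L v)) = (\<Sum>v\<in>Vx. card (shadow (L v)))"
    using fVx fS disj by (intro card_UN_disjoint) auto
  ultimately have sum_le: "(\<Sum>v\<in>Vx. real (card (shadow (L v)))) \<le> real n ^ (k - 2)"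
    by (simp flip: of_nat_sum of_nat_power)
  have "G \<subseteq> (\<Union>v\<in>Vx. {E \<in> G. v \<in> E})"
  proof
    fix E assume E: "E \<in> G"
    then have "x \<in> col ` E" using G x by (auto simp: rainbow_def bij_betw_def)
    then show "E \<in> (\<Union>v\<in>Vx. {E \<in> G. v \<in> E})" using E G by (auto simp: Vx_def)
  qed
  then have "card G \<le> card (\<Union>v\<in>Vx. {E \<in> G. v \<in> E})" using fVx fG by (intro card_mono) auto
  then have "real (card G) \<le> (\<Sum>v\<in>Vx. real (card {E \<in> G. v \<in> E}))"
    using real_card_UN_le[OF fVx, of "\<lambda>v. {E \<in> G. v \<in> E}"] by linarith
  also have "\<dots> = (\<Sum>v\<in>Vx. real (card (L v)))" by (simp add: cL hdegree_def)
  also have "\<dots> \<le> (\<Sum>v\<in>Vx. d * real (card (shadow (L v))))" using L_le by (intro sum_mono)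
  also have "\<dots> \<le> d * real n ^ (k - 2)" using sum_le d by (simp flip: sum_distrib_left)
  also have "\<dots> = \<delta>' / 2 * real n ^ (Suc (k - 2))" by (simp add: d_def)
  also have "Suc (k - 2) = k - 1" using \<open>k \<ge> 2\<close> by simp
  also have "\<delta>' / 2 * real n ^ (k - 1) < \<delta>' * real n ^ (k - 1)" using \<delta>' V by simp
  finally show False using large by simp
qed

text \<open>A rainbow, then a homogeneous subfamily is taken. The degree bound excludes the case of
  a determined colour, and in the other case \<open>H\<close> embeds with its private vertices on
  two colours. The bound has order \<open>n ^ (s - t)\<close>.\<close>

lemma card_emb_ge_no_heavy_vertex:
  fixes \<delta> :: real and H :: "'a set set"
  assumes "k \<ge> 2" and H: "hypertree H" "uniform k H" "two_contractible H" and "\<delta> > 0"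
  shows "\<exists>\<epsilon>>0. \<exists>\<beta>>0. \<exists>n0. \<forall>(V::'b set) n G. finite V \<longrightarrow> card V = n \<longrightarrow> n \<ge> n0 \<longrightarrow> G \<subseteq> Pow V \<longrightarrow>
    uniform k G \<longrightarrow> \<delta> * real n ^ (k - 1) \<le> real (card G) \<longrightarrow>
    (\<forall>v. real (hdegree G v) < \<epsilon> * real n ^ (k - 1)) \<longrightarrow>
    (\<exists>Z U. (\<beta> / real n) ^ card H * real n ^ card (hverts H) \<le> real (card (emb H G Z U)))"
proof -
  define q where "q = card (hverts H)"
  define \<delta>0 where "\<delta>0 = \<delta> / real (k ^ k)"
  have k: "k > 0" using assms by simp
  have "\<delta>0 > 0" using assms by (simp add: \<delta>0_def)
  obtain \<delta>' c where pos: "\<delta>' > 0" "c > 0" and hom: "\<forall>(V::'b set) n G col. finite V \<longrightarrow> card V = n \<longrightarrow>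
    n > 0 \<longrightarrow> G \<subseteq> Pow V \<longrightarrow> rainbow k col G \<longrightarrow> \<delta>0 * real n ^ (k - 1) \<le> real (card G) \<longrightarrow>
    (\<exists>Gs \<subseteq> G. \<delta>' * real n ^ (k - 1) \<le> real (card Gs) \<and>
      (\<forall>E\<in>Gs. \<forall>A\<in>closed_cols k col Gs. A \<noteq> {..<k} \<longrightarrow>
         robust q (c * real n ^ (k - 1 - card A)) Gs (cpart col A E)))"
    using homogeneous_subfamily[OF k \<open>\<delta>0 > 0\<close>, of q, where 'b = 'b] by (elim exE conjE) (rule that)
  have fH: "finite H" using H hypertree_finite by blast
  have fVH: "finite (hverts H)" using fH H finite_hverts by blast
  obtain Z where "\<forall>E\<in>H. card (E \<inter> Z) = 2" "\<forall>E\<in>H. \<forall>F\<in>H. E \<noteq> F \<longrightarrow> E \<inter> F \<inter> Z = {}"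
    using two_contractible_private[OF fH H(2,3)] by (elim exE conjE) (rule that)
  note Z = this[rule_format]
  define \<epsilon> where "\<epsilon> = (\<delta>' / 2) ^ (k - 1) / fact (k - 1)"
  have \<epsilon>: "\<epsilon> > 0" using pos by (simp add: \<epsilon>_def)
  \<comment> \<open>Ensures \<open>1 < \<delta>' * n\<close>, so that the homogeneous subfamily has
    more than \<open>n ^ (k - 2)\<close> edges, as the case distinction on closed colour sets
    requires.\<close>
  define n0 where "n0 = nat \<lceil>1 / \<delta>'\<rceil> + 1"
  have "\<exists>Z U. (c / real n) ^ card H * real n ^ card (hverts H) \<le> real (card (emb H G Z U))"
    if V: "finite V" "card V = n" and n: "n \<ge> n0" and G: "G \<subseteq> Pow V" "uniform k G"
      and large: "\<delta> * real n ^ (k - 1) \<le> real (card G)"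
      and light: "\<forall>v. real (hdegree G v) < \<epsilon> * real n ^ (k - 1)" for V :: "'b set" and n G
  proof -
    have n_pos: "n > 0" using n by (simp add: n0_def)
    have "1 / \<delta>' < real n" using n unfolding n0_def by linarith
    then have \<delta>'n: "1 < \<delta>' * real n" using pos by (simp add: field_simps)
    have fG: "finite G" using V G finite_subset by blast
    obtain col where col: "card G \<le> k ^ k * card {E \<in> G. bij_betw col E {..<k}}"
      using ex_rainbow_subfamily[OF V(1) G k] by blast
    define G0 where "G0 = {E \<in> G. bij_betw col E {..<k}}"
    have G0: "G0 \<subseteq> Pow V" "rainbow k col G0" using G by (auto simp: G0_def rainbow_def)
    have "\<delta> * real n ^ (k - 1) \<le> real (k ^ k) * real (card G0)"
    proof -
      have "real (card G) \<le> real (k ^ k * card G0)" using col unfolding G0_def by (simp only: of_nat_le_iff)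
      then show ?thesis using large by (simp only: of_nat_mult)
    qed
    then have "\<delta>0 * real n ^ (k - 1) \<le> real (card G0)" using k by (simp add: \<delta>0_def field_simps)
    from hom[rule_format, OF V n_pos G0 this] obtain Gs where Gs: "Gs \<subseteq> G0"
      and Gs_large: "\<delta>' * real n ^ (k - 1) \<le> real (card Gs)"
      and rob: "\<forall>E\<in>Gs. \<forall>A\<in>closed_cols k col Gs. A \<noteq> {..<k} \<longrightarrow>
         robust q (c * real n ^ (k - 1 - card A)) Gs (cpart col A E)"
      by (elim exE conjE) (rule that)
    have Gs': "Gs \<subseteq> Pow V" "rainbow k col Gs" "Gs \<subseteq> G" using G0 Gs by (auto simp: rainbow_def G0_def)
    have fGs: "finite Gs" using Gs'(3) fG by (rule finite_subset)
    have "k - 1 = Suc (k - 2)" using \<open>k \<ge> 2\<close> by simp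
    then have "\<delta>' * real n ^ (k - 1) = (\<delta>' * real n) * real n ^ (k - 2)" by simp
    moreover have "1 * real n ^ (k - 2) < (\<delta>' * real n) * real n ^ (k - 2)"
      using \<delta>'n n_pos by (intro mult_strict_right_mono) auto
    ultimately have "real n ^ (k - 2) < real (card Gs)" using Gs_large by linarith
    then have "real (n ^ (k - 2)) < real (card Gs)" by simp
    then have rank: "n ^ (k - 2) < card Gs" by (simp only: of_nat_less_iff)
    then have "Gs \<noteq> {}" by auto
    from closed_cols_cases[OF V Gs'(1,2) \<open>k \<ge> 2\<close> rank] show ?thesis
    proof cases
      case (1 x y)
      \<comment> \<open>Each edge of \<open>Gs\<close> has exactly two vertices in \<open>U\<close>,
        matching the two private vertices. A set avoiding \<open>U\<close> misses the colours
        \<open>x\<close> and \<open>y\<close>, so its colour set is closed and the set is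
        robust.\<close>
      define U where "U = {v. col v \<in> {x, y}}"
      have "(c / real n) ^ card H * real n ^ card (hverts H) \<le> real (card (emb H Gs Z U))"
      proof (rule card_emb_ge[OF H(1,2) _ Z(2) Z(1)])
        show "card (hverts H) \<le> q" by (simp add: q_def)
        show "uniform k Gs" using Gs' uniform_rainbow by blast
        show "0 \<le> c / real n" using pos by simp
      next
        fix E assume E: "E \<in> Gs"
        have "E \<inter> U = cpart col {x, y} E" by (auto simp: U_def cpart_def)
        then show "card (E \<inter> U) = 2"
          using image_cpart(2)[OF Gs'(2) E, of "{x, y}"] 1 by simp
      next
        fix E D W assume E: "E \<in> Gs" "D \<subset> E" "D \<inter> U = {}" and W: "finite W" "card W \<le> q" "W \<inter> D = {}"
        have b: "bij_betw col E {..<k}" using Gs' E by (auto simp: rainbow_def)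
        then have "col ` D \<subseteq> {..<k} - {x, y}" using E by (auto simp: U_def bij_betw_def)
        then have cl: "col ` D \<in> closed_cols k col Gs" and ne: "col ` D \<noteq> {..<k}" using 1 by auto
        have "cpart col (col ` D) E = D" using cpart_eq[OF Gs'(2) E(1)] E by blast
        then have "robust q (c * real n ^ (k - 1 - card (col ` D))) Gs D"
          using bspec[OF bspec[OF rob E(1)] cl] ne by simp
        moreover have "card (col ` D) = card D"
          using b E by (intro card_image) (auto simp: bij_betw_def intro: inj_on_subset)
        ultimately have ge: "c * real n ^ (k - 1 - card D) \<le> real (card {E' \<in> Gs. D \<subseteq> E' \<and> E' \<inter> W = {}})"
          using W by (simp add: robust_def)
        have "finite E" "card E = k" using G Gs' E by (auto simp: uniform_def)
        then have "card D < k" using E psubset_card_mono by blast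
        then have "k - card D = Suc (k - 1 - card D)" by simp
        then show "c / real n * real n ^ (k - card D) \<le> real (card {E' \<in> Gs. D \<subseteq> E' \<and> E' \<inter> W = {}})"
          using ge n_pos by simp
      qed (use fGs \<open>Gs \<noteq> {}\<close> k in auto)
      also have "\<dots> \<le> real (card (emb H G Z U))"
        using card_emb_mono[OF Gs'(3) fVH] finite_hverts[OF fG G(2)] by simp
      finally show ?thesis by blast
    next
      case (2 x)
      obtain v where "\<epsilon> * real n ^ (k - 1) \<le> real (hdegree Gs v)"
        using determined_color_imp_high_degree[OF V n_pos Gs'(1,2) \<open>k \<ge> 2\<close> pos(1) Gs_large 2]
        unfolding \<epsilon>_def by blast
      moreover have "hdegree Gs v \<le> hdegree G v"
        unfolding hdegree_def using Gs'(3) fG by (intro card_mono) auto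
      ultimately have "\<epsilon> * real n ^ (k - 1) \<le> real (hdegree G v)" by linarith
      then show ?thesis using light by (meson not_le)
    qed
  qed
  then show ?thesis by (intro exI[of _ \<epsilon>] exI[of _ c] exI[of _ n0] conjI allI impI pos \<epsilon>)
qed

section \<open>Common links of heavy vertices\<close>

text \<open>Removing \<open>S\<close> from every edge preserves the attaching condition; injectivity
  keeps a new edge from coinciding with an old one.\<close>

lemma hypertree_Diff:
  assumes "hypertree H" "inj_on (\<lambda>E. E - S) H"
  shows "hypertree ((\<lambda>E. E - S) ` H)"
  using assms
proof (induction rule: hypertree.induct)
  case (single E)
  then show ?case by (simp add: hypertree.single)
next
  case (extend H' E F)
  have "hypertree ((\<lambda>E. E - S) ` H')" using extend by (simp add: inj_on_insert)
  moreover have "E - S \<notin> (\<lambda>E. E - S) ` H'" using extend.prems extend.hyps by (simp add: inj_on_insert)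
  moreover have "F - S \<in> (\<lambda>E. E - S) ` H'" using extend.hyps by simp
  moreover have "hverts ((\<lambda>E. E - S) ` H') = hverts H' - S" by (auto simp: hverts_def)
  then have "(E - S) \<inter> hverts ((\<lambda>E. E - S) ` H') = (E - S) \<inter> (F - S)"
    using extend.hyps by auto
  ultimately have "hypertree (insert (E - S) ((\<lambda>E. E - S) ` H'))" by (rule hypertree.extend)
  then show ?case by simp
qed

text \<open>Removing the cross-cut leaves a \<open>(k - 1)\<close>-uniform hypertree with as many
  edges, which embeds into \<open>L\<close> by the dense case. Mapping \<open>S\<close> onto
  \<open>S'\<close> completes the embedding: an edge has one vertex in \<open>S\<close>, and any
  vertex of \<open>S'\<close> extends any member of \<open>L\<close> to an edge.\<close>

lemma card_emb_ge_common_link: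
  fixes A :: real and H :: "'a set set" and V :: "'b set"
  assumes "k \<ge> 2" and H: "hypertree H" "uniform k H" "two_contractible H" and S: "cross_cut H S"
    and V: "finite V" "card V = n" "n > 0" and F: "F \<subseteq> Pow V" "uniform k F"
    and S': "finite S'" "card S' = card S"
    and L: "L \<subseteq> Pow V" "uniform (k - 1) L" "\<And>D. D \<in> L \<Longrightarrow> D \<inter> S' = {}"
      "\<And>D x. D \<in> L \<Longrightarrow> x \<in> S' \<Longrightarrow> insert x D \<in> F"
    and A: "A > 0" "A \<ge> 4 * real (k - 1) * real (card (hverts H))" "A * real n ^ (k - 2) \<le> real (card L)"
  shows "(A / (4 * real (k - 1) * real n)) ^ card H * real n ^ (card (hverts H) - card S)
    \<le> real (card (emb H F {} {}))"
proof -
  have fH: "finite H" using H hypertree_finite by blast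
  have fVH: "finite (hverts H)" using fH H finite_hverts by blast
  have SV: "S \<subseteq> hverts H" and SE: "\<And>E. E \<in> H \<Longrightarrow> card (E \<inter> S) = 1" using S by (auto simp: cross_cut_def)
  have fS: "finite S" using SV fVH by (rule finite_subset)
  obtain Z where "\<forall>E\<in>H. card (E \<inter> Z) = 2" "\<forall>E\<in>H. \<forall>F\<in>H. E \<noteq> F \<longrightarrow> E \<inter> F \<inter> Z = {}"
    using two_contractible_private[OF fH H(2,3)] by (elim exE conjE) (rule that)
  note Z = this[rule_format]
  have inj: "inj_on (\<lambda>E. E - S) H"
  proof (rule inj_onI, rule ccontr)
    fix E E' assume E: "E \<in> H" "E' \<in> H" "E - S = E' - S" "E \<noteq> E'"
    \<comment> \<open>A private vertex of \<open>E\<close> outside \<open>S\<close> would also lie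
      in \<open>E'\<close>. So both private vertices would be in \<open>S\<close>, which meets
      \<open>E\<close> only once.\<close>
    have "E \<inter> Z \<subseteq> E \<inter> S" using Z(2)[OF E(1,2,4)] E(3) by blast
    then have "card (E \<inter> Z) \<le> card (E \<inter> S)" using fS by (intro card_mono) auto
    then show False using Z(1) SE E(1) by simp
  qed
  define H' where "H' = (\<lambda>E. E - S) ` H"
  have H': "hypertree H'" "card H' = card H"
    using hypertree_Diff[OF H(1) inj] card_image[OF inj] by (auto simp: H'_def)
  have hH': "hverts H' = hverts H - S" by (auto simp: H'_def hverts_def)
  have uH': "uniform (k - 1) H'"
    unfolding uniform_def
  proof
    fix E' assume "E' \<in> H'"
    then obtain E where E: "E \<in> H" "E' = E - S" by (auto simp: H'_def)
    then have "finite E" "card E = k" using H by (auto simp: uniform_def)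
    then show "finite E' \<and> card E' = k - 1" using SE[OF E(1)] E by (simp add: card_Diff_subset_Int)
  qed
  have cV: "card (hverts H') = card (hverts H) - card S"
    unfolding hH' using fS SV by (rule card_Diff_subset)
  have "k - 1 > 0" "k - 1 - 1 = k - 2" using \<open>k \<ge> 2\<close> by auto
  then have "(A / (4 * real (k - 1) * real n)) ^ card H' * real n ^ card (hverts H') \<le> real (card (emb H' L {} {}))"
    using A L cV by (intro card_emb_ge_dense[OF V, where q = "card (hverts H)"] H' uH') auto
  moreover have "card (emb H' L {} {}) \<le> card (emb H F {} {})"
  proof -
    obtain \<pi> where \<pi>: "bij_betw \<pi> S S'" using finite_same_card_bij[OF fS S'(1)] S'(2) by auto
    define \<Phi> where "\<Phi> f = (\<lambda>v. if v \<in> S then \<pi> v else f v)" for f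
    have "inj_on \<Phi> (emb H' L {} {})"
    proof (rule inj_onI)
      fix f g assume fg: "f \<in> emb H' L {} {}" "g \<in> emb H' L {} {}" "\<Phi> f = \<Phi> g"
      show "f = g"
      proof
        fix v show "f v = g v"
          using fg(1,2) fun_cong[OF fg(3), of v]
          by (cases "v \<in> S") (auto simp: \<Phi>_def emb_def hH' extensional_def)
      qed
    qed
    moreover have "\<Phi> ` emb H' L {} {} \<subseteq> emb H F {} {}"
    proof (rule image_subsetI)
      fix f assume f: "f \<in> emb H' L {} {}"
      have fext: "f \<in> extensional (hverts H - S)" and finj: "inj_on f (hverts H - S)"
        and "\<forall>E'\<in>H'. f ` E' \<in> L"
        using f unfolding emb_def hH' by blast+
      then have fL: "f ` (E - S) \<in> L" if "E \<in> H" for E using that by (simp add: H'_def)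
      have \<Phi>S: "\<Phi> f v = \<pi> v" if "v \<in> S" for v using that by (simp add: \<Phi>_def)
      have \<Phi>n: "\<Phi> f v = f v" if "v \<notin> S" for v using that by (simp add: \<Phi>_def)
      \<comment> \<open>Vertices outside \<open>S\<close> are mapped into members of
        \<open>L\<close>, which avoid \<open>S'\<close>; this keeps the combined map
        injective.\<close>
      have fS': "f v \<notin> S'" if v: "v \<in> hverts H - S" for v
      proof -
        obtain E where "E \<in> H" "v \<in> E - S" using v by (auto simp: hverts_def)
        then show ?thesis using fL[of E] L(3) by blast
      qed
      have \<pi>S: "\<pi> ` S = S'" "inj_on \<pi> S" using \<pi> by (auto simp: bij_betw_def)
      have "\<Phi> f \<in> extensional (hverts H)"
        using fext SV by (auto simp: \<Phi>_def extensional_def)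
      moreover have "inj_on (\<Phi> f) (hverts H)"
      proof (rule inj_onI)
        fix u v assume uv: "u \<in> hverts H" "v \<in> hverts H" "\<Phi> f u = \<Phi> f v"
        consider "u \<in> S" "v \<in> S" | "u \<in> S" "v \<notin> S" | "u \<notin> S" "v \<in> S" | "u \<notin> S" "v \<notin> S" by blast
        then show "u = v"
        proof cases
          case 1
          then show ?thesis using uv \<pi>S(2) \<Phi>S by (metis inj_onD)
        next
          case 2
          then have "f v \<in> S'" using uv(3) \<Phi>S \<Phi>n \<pi>S(1) by (metis imageI)
          then show ?thesis using fS' 2 uv by blast
        next
          case 3
          then have "f u \<in> S'" using uv(3) \<Phi>S \<Phi>n \<pi>S(1) by (metis imageI)
          then show ?thesis using fS' 3 uv by blast
        next
          case 4
          then show ?thesis using uv finj \<Phi>n by (simp add: inj_on_def)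
        qed
      qed
      moreover have "\<Phi> f ` E \<in> F" if E: "E \<in> H" for E
      proof -
        obtain w where w: "E \<inter> S = {w}" using SE[OF E] by (auto simp: card_1_singleton_iff)
        have "E = insert w (E - S)" using w by blast
        then have "\<Phi> f ` E = insert (\<Phi> f w) (\<Phi> f ` (E - S))" by (metis image_insert)
        moreover have "\<Phi> f ` (E - S) = f ` (E - S)" using \<Phi>n by (intro image_cong) auto
        moreover have "\<Phi> f w \<in> S'" using w \<Phi>S \<pi>S(1) by blast
        ultimately show ?thesis using L(4)[OF fL[OF E]] by simp
      qed
      ultimately show "\<Phi> f \<in> emb H F {} {}" by (simp add: emb_def)
    qed
    moreover have "finite F" using V F by (meson finite_Pow_iff finite_subset)
    then have "finite (emb H F {} {})" using fVH finite_hverts[OF _ F(2)] by (intro finite_emb)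
    ultimately show ?thesis by (intro card_inj_on_le)
  qed
  ultimately show ?thesis unfolding cV H'(2) by linarith
qed

text \<open>Each \<open>(k - 1)\<close>-set \<open>D\<close> outside \<open>X\<close> with fewer
  than \<open>\<sigma>\<close> extensions by a vertex of \<open>X\<close> accounts for at most
  \<open>\<sigma> - 1\<close> edges, so the surplus forces many \<open>D\<close> with at least
  \<open>\<sigma>\<close> extensions. Pigeonhole over the at most \<open>2 ^ M\<close> subsets of
  \<open>X\<close> finds a common set of \<open>\<sigma>\<close> vertices.\<close>

lemma ex_dense_common_link:
  fixes \<eta> :: real
  assumes V: "finite V" "card V = n" and F: "F \<subseteq> Pow V" "uniform k F"
    and X: "X \<subseteq> V" "card X \<le> M" "M > 0" and "\<sigma> > 0" "\<eta> > 0" "k - 1 \<le> n"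
    and large: "(real \<sigma> - 1 + \<eta>) * real (n choose (k - 1)) \<le> real (card {E \<in> F. card (E \<inter> X) = 1})"
  shows "\<exists>S' \<subseteq> X. card S' = \<sigma> \<and> \<eta> / (real M * 2 ^ M) * real (n choose (k - 1))
    \<le> real (card {D. D \<subseteq> V - X \<and> card D = k - 1 \<and> (\<forall>x\<in>S'. insert x D \<in> F)})"
proof -
  define \<D> where "\<D> = {D. D \<subseteq> V - X \<and> card D = k - 1}"
  define T where "T D = {x \<in> X. insert x D \<in> F}" for D
  define B where "B = {D \<in> \<D>. card (T D) \<ge> \<sigma>}"
  define Lk where "Lk S' = {D. D \<subseteq> V - X \<and> card D = k - 1 \<and> (\<forall>x\<in>S'. insert x D \<in> F)}" for S'
  define \<S> where "\<S> = {S'. S' \<subseteq> X \<and> card S' = \<sigma>}"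
  define N where "N = real (n choose (k - 1))"
  have fX: "finite X" using X(1) V(1) by (rule finite_subset)
  have f\<D>: "finite \<D>" using V by (simp add: \<D>_def)
  have fT: "finite (T D)" and cT: "card (T D) \<le> M" for D
  proof -
    show "finite (T D)" using fX by (simp add: T_def)
    have "card (T D) \<le> card X" using fX by (intro card_mono) (auto simp: T_def)
    then show "card (T D) \<le> M" using X by simp
  qed
  have "card \<D> \<le> card {D. D \<subseteq> V \<and> card D = k - 1}" using V by (intro card_mono) (auto simp: \<D>_def)
  also have "\<dots> = n choose (k - 1)" using V by (simp add: n_subsets)
  finally have c\<D>: "real (card \<D>) \<le> N" by (simp add: N_def)
  have "{E \<in> F. card (E \<inter> X) = 1} \<subseteq> (\<lambda>(D, x). insert x D) ` Sigma \<D> T"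
  proof
    fix E assume E: "E \<in> {E \<in> F. card (E \<inter> X) = 1}"
    then obtain x where x: "E \<inter> X = {x}" by (auto simp: card_1_singleton_iff)
    have E': "E \<subseteq> V" "finite E" "card E = k" using E F by (auto simp: uniform_def)
    have ins: "insert x (E - {x}) = E" using x by blast
    have "E - {x} \<subseteq> V - X" using x E' by blast
    moreover have "card (E - {x}) = k - 1" using x E' by (subst card_Diff_singleton) auto
    moreover have "x \<in> T (E - {x})" using x E ins by (auto simp: T_def)
    ultimately have "(E - {x}, x) \<in> Sigma \<D> T" by (simp add: \<D>_def)
    then show "E \<in> (\<lambda>(D, x). insert x D) ` Sigma \<D> T" using ins by (intro image_eqI[of _ _ "(E - {x}, x)"]) simp_all
  qed
  then have "card {E \<in> F. card (E \<inter> X) = 1} \<le> card (Sigma \<D> T)"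
    using f\<D> fT by (intro surj_card_le) auto
  also have "\<dots> = (\<Sum>D\<in>\<D>. card (T D))" using f\<D> fT by (intro card_SigmaI) auto
  \<comment> \<open>Outside \<open>B\<close> there are at most \<open>\<sigma> - 1\<close>
    extensions; in \<open>B\<close> the crude bound \<open>M\<close> is enough.\<close>
  also have "\<dots> \<le> (\<Sum>D\<in>\<D>. (\<sigma> - 1) + (if D \<in> B then M else 0))"
    using cT by (intro sum_mono) (auto simp: B_def intro: trans_le_add2)
  also have "\<dots> = (\<sigma> - 1) * card \<D> + M * card B"
    using f\<D> by (simp add: sum.distrib sum.If_cases B_def Int_def mult.commute)
  finally have "real (card {E \<in> F. card (E \<inter> X) = 1}) \<le> real ((\<sigma> - 1) * card \<D> + M * card B)"
    by (simp only: of_nat_le_iff)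
  also have "\<dots> = (real \<sigma> - 1) * real (card \<D>) + real M * real (card B)"
    using \<open>\<sigma> > 0\<close> by (simp add: of_nat_diff)
  also have "\<dots> \<le> (real \<sigma> - 1) * N + real M * real (card B)"
    using c\<D> \<open>\<sigma> > 0\<close> by (intro add_right_mono mult_left_mono) auto
  finally have "\<eta> * N \<le> real M * real (card B)" using large by (simp add: N_def algebra_simps)
  then have cB: "\<eta> / real M * N \<le> real (card B)" using X by (simp add: field_simps)
  have f\<S>: "finite \<S>" using fX by (simp add: \<S>_def)
  have "card \<S> \<le> card (Pow X)" using fX by (intro card_mono) (auto simp: \<S>_def)
  also have "\<dots> = 2 ^ card X" using fX by (rule card_Pow)
  also have "\<dots> \<le> 2 ^ M" using X by (intro power_increasing) auto
  finally have c\<S>: "card \<S> \<le> 2 ^ M" .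
  have sub: "B \<subseteq> (\<Union>S'\<in>\<S>. Lk S')"
  proof
    fix D assume D: "D \<in> B"
    then obtain S' where "S' \<subseteq> T D" "card S' = \<sigma>" by (auto simp: B_def elim: obtain_subset_with_card_n)
    then show "D \<in> (\<Union>S'\<in>\<S>. Lk S')" using D by (auto simp: \<S>_def Lk_def T_def B_def \<D>_def)
  qed
  have fLk: "finite (Lk S')" for S'
    by (rule finite_subset[OF _ f\<D>]) (auto simp: Lk_def \<D>_def)
  show ?thesis
  proof (rule ccontr)
    assume "\<not> ?thesis"
    then have less: "real (card (Lk S')) < \<eta> / (real M * 2 ^ M) * N" if "S' \<in> \<S>" for S'
      using that unfolding \<S>_def Lk_def N_def by (auto simp: not_le)
    have "card B \<le> card (\<Union>S'\<in>\<S>. Lk S')" using f\<S> fLk sub by (intro card_mono) auto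
    then have le: "real (card B) \<le> (\<Sum>S'\<in>\<S>. real (card (Lk S')))"
      using real_card_UN_le[OF f\<S>, of Lk] by linarith
    have "0 < N" using \<open>k - 1 \<le> n\<close> by (simp add: N_def)
    then have "0 < \<eta> / real M * N" using \<open>\<eta> > 0\<close> X by simp
    then have "B \<noteq> {}" using cB by auto
    then have "\<S> \<noteq> {}" using sub by auto
    have "(\<Sum>S'\<in>\<S>. real (card (Lk S'))) < (\<Sum>S'\<in>\<S>. \<eta> / (real M * 2 ^ M) * N)"
      using f\<S> \<open>\<S> \<noteq> {}\<close> less by (intro sum_strict_mono) auto
    also have "\<dots> = real (card \<S>) * (\<eta> / (real M * 2 ^ M) * N)" by simp
    also have "\<dots> \<le> real (2 ^ M) * (\<eta> / (real M * 2 ^ M) * N)"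
      using c\<S> \<open>0 < N\<close> \<open>\<eta> > 0\<close> by (intro mult_right_mono) (simp_all only: of_nat_le_iff, simp)
    also have "\<dots> = \<eta> / real M * N" by simp
    finally show False using le cB by linarith
  qed
qed

section \<open>Splitting off the heavy vertices at bounded density\<close>

lemma sum_hdegree_le:
  assumes "finite F" "uniform k F" "finite X"
  shows "(\<Sum>x\<in>X. hdegree F x) \<le> k * card F"
proof -
  have "(\<Sum>x\<in>X. hdegree F x) = (\<Sum>x\<in>X. \<Sum>E\<in>F. if x \<in> E then 1 else 0)"
    using assms by (simp add: hdegree_def sum.If_cases Int_def)
  also have "\<dots> = (\<Sum>E\<in>F. \<Sum>x\<in>X. if x \<in> E then 1 else 0)" by (rule sum.swap)
  also have "\<dots> = (\<Sum>E\<in>F. card (X \<inter> E))" using assms by (simp add: sum.If_cases Int_def)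
  also have "\<dots> \<le> (\<Sum>E\<in>F. k)"
  proof (rule sum_mono)
    fix E assume "E \<in> F"
    then have "finite E" "card E = k" using assms by (auto simp: uniform_def)
    then show "card (X \<inter> E) \<le> k" using card_mono[of E "X \<inter> E"] by simp
  qed
  finally show ?thesis by (simp add: mult.commute)
qed

text \<open>Such an edge contains one of at most \<open>M ^ 2\<close> ordered pairs from
  \<open>X\<close>, and a pair lies in at most \<open>n ^ (k - 2)\<close> edges: an error of lower
  order.\<close>

lemma card_meets_twice_le:
  assumes V: "finite V" "card V = n" and F: "F \<subseteq> Pow V" "uniform k F" and X: "X \<subseteq> V" "card X \<le> M"
  shows "real (card {E \<in> F. card (E \<inter> X) \<ge> 2}) \<le> real M ^ 2 * real n ^ (k - 2)"
proof -
  define I where "I = {(x, y). x \<in> X \<and> y \<in> X \<and> x \<noteq> y}"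
  have fX: "finite X" using X(1) V(1) by (rule finite_subset)
  have I: "I \<subseteq> X \<times> X" by (auto simp: I_def)
  then have fI: "finite I" by (rule finite_subset) (use fX in simp)
  have "card I \<le> card (X \<times> X)" using I fX by (intro card_mono) auto
  also have "\<dots> \<le> M * M" using X by (simp add: card_cartesian_product mult_le_mono)
  finally have cI: "real (card I) \<le> real (M * M)" by (simp only: of_nat_le_iff)
  have "{E \<in> F. card (E \<inter> X) \<ge> 2} \<subseteq> (\<Union>(x, y)\<in>I. {E. {x, y} \<subseteq> E \<and> E \<subseteq> V \<and> card E = k})"
  proof
    fix E assume E: "E \<in> {E \<in> F. card (E \<inter> X) \<ge> 2}"
    then obtain P where "P \<subseteq> E \<inter> X" "card P = 2" using obtain_subset_with_card_n[of 2 "E \<inter> X"] by blast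
    then obtain x y where "x \<in> E" "y \<in> E" "x \<in> X" "y \<in> X" "x \<noteq> y" by (auto simp: card_2_iff)
    moreover have "E \<subseteq> V" "card E = k" using E F by (auto simp: uniform_def)
    ultimately show "E \<in> (\<Union>(x, y)\<in>I. {E. {x, y} \<subseteq> E \<and> E \<subseteq> V \<and> card E = k})"
      by (intro UN_I[of "(x, y)"]) (auto simp: I_def)
  qed
  then have "card {E \<in> F. card (E \<inter> X) \<ge> 2} \<le> card (\<Union>(x, y)\<in>I. {E. {x, y} \<subseteq> E \<and> E \<subseteq> V \<and> card E = k})"
    using fI V by (intro card_mono finite_UN_I) auto
  then have "real (card {E \<in> F. card (E \<inter> X) \<ge> 2})
      \<le> (\<Sum>(x, y)\<in>I. real (card {E. {x, y} \<subseteq> E \<and> E \<subseteq> V \<and> card E = k}))"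
    using real_card_UN_le[OF fI, of "\<lambda>(x, y). {E. {x, y} \<subseteq> E \<and> E \<subseteq> V \<and> card E = k}"]
    by (simp add: case_prod_unfold)
  also have "\<dots> \<le> (\<Sum>(x, y)\<in>I. real n ^ (k - 2))"
  proof (intro sum_mono, clarify)
    fix x y assume "(x, y) \<in> I"
    then have "{x, y} \<subseteq> V" "card {x, y} = 2" using X by (auto simp: I_def)
    then show "real (card {E. {x, y} \<subseteq> E \<and> E \<subseteq> V \<and> card E = k}) \<le> real n ^ (k - 2)"
      using card_supersets_le[OF V, of "{x, y}" k] by simp
  qed
  also have "\<dots> = real (card I) * real n ^ (k - 2)" by simp
  also have "\<dots> \<le> real (M * M) * real n ^ (k - 2)" using cI by (intro mult_right_mono) auto
  finally show ?thesis by (simp add: power2_eq_square)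
qed

text \<open>The edges cover the cross-cut, each by a single vertex. This makes
  \<open>n ^ (s - \<sigma>)\<close> at least \<open>n ^ (s - t)\<close>.\<close>

lemma card_cross_cut_le:
  assumes "finite H" "cross_cut H S"
  shows "card S \<le> card H"
proof -
  have "S = (\<Union>E\<in>H. E \<inter> S)" using assms(2) by (auto simp: cross_cut_def hverts_def)
  then have "card S \<le> (\<Sum>E\<in>H. card (E \<inter> S))" using card_UN_le[OF assms(1), of "\<lambda>E. E \<inter> S"] by simp
  also have "\<dots> = card H" using assms(2) by (simp add: cross_cut_def)
  finally show ?thesis .
qed

text \<open>One private vertex from each edge forms a cross-cut and injects the edges into the
  vertices, so the natural subtraction \<open>s - t\<close> does not truncate.\<close>

lemma two_contractible_ex_cross_cut:
  assumes "finite H" "uniform k H" "two_contractible H"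
  shows "\<exists>S. cross_cut H S" "card H \<le> card (hverts H)"
proof -
  obtain Z where Z: "Z \<subseteq> hverts H" "\<forall>E\<in>H. card (E \<inter> Z) = 2"
    "\<forall>E\<in>H. \<forall>F\<in>H. E \<noteq> F \<longrightarrow> E \<inter> F \<inter> Z = {}"
    using two_contractible_private[OF assms] by (elim exE conjE) (rule that)
  have "\<forall>E\<in>H. \<exists>v. v \<in> E \<inter> Z"
  proof
    fix E assume "E \<in> H"
    then have "E \<inter> Z \<noteq> {}" using Z(2) by fastforce
    then show "\<exists>v. v \<in> E \<inter> Z" by blast
  qed
  then have "\<exists>p. \<forall>E\<in>H. p E \<in> E \<inter> Z" by (rule bchoice)
  then obtain p where p: "\<forall>E\<in>H. p E \<in> E \<inter> Z" by (rule exE)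
  have uniq: "E = F" if "E \<in> H" "F \<in> H" "p F \<in> E" for E F
  proof (rule ccontr)
    assume "E \<noteq> F"
    then have "E \<inter> F \<inter> Z = {}" using Z(3) that by blast
    moreover have "p F \<in> F \<inter> Z" using p that by blast
    ultimately show False using that by blast
  qed
  have "E \<inter> p ` H = {p E}" if "E \<in> H" for E
  proof
    show "E \<inter> p ` H \<subseteq> {p E}" using uniq[OF that] by blast
    show "{p E} \<subseteq> E \<inter> p ` H" using p that by blast
  qed
  moreover have "p ` H \<subseteq> hverts H" using p Z(1) by blast
  ultimately have "cross_cut H (p ` H)" by (simp add: cross_cut_def)
  then show "\<exists>S. cross_cut H S" by blast
  have "inj_on p H" using uniq p by (intro inj_onI) (metis IntD1)
  then show "card H \<le> card (hverts H)"
    using \<open>p ` H \<subseteq> hverts H\<close> finite_hverts[OF assms(1,2)] by (rule card_inj_on_le)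
qed

lemma power_le_binomial:
  assumes "m \<le> n"
  shows "real n ^ m \<le> real m ^ m * real (n choose m)"
proof (cases "m = 0")
  case False
  have "(real n / real m) ^ m \<le> real (n choose m)" using assms by (rule binomial_ge_n_over_k_pow_k)
  then show ?thesis using False by (simp add: power_divide field_simps)
qed simp

text \<open>Bounded density leaves boundedly many heavy vertices, forming \<open>X\<close>. Either
  the edges avoiding \<open>X\<close> have positive density and no heavy vertex, or almost all edges
  meet \<open>X\<close> exactly once and some \<open>\<sigma>\<close> vertices of \<open>X\<close>
  have a dense common link.\<close>

lemma card_emb_ge_bounded_density:
  fixes \<gamma> C :: real and H :: "'a set set"
  assumes "k \<ge> 2" and H: "hypertree H" "uniform k H" "two_contractible H" and S: "cross_cut H S"
    and "\<gamma> > 0" "C > 0"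
  shows "\<exists>\<beta>>0. \<exists>n0. \<forall>(V::'b set) n F. finite V \<longrightarrow> card V = n \<longrightarrow> n \<ge> n0 \<longrightarrow> F \<subseteq> Pow V \<longrightarrow> uniform k F \<longrightarrow>
    (real (card S) - 1 + \<gamma>) * real (n choose (k - 1)) \<le> real (card F) \<longrightarrow>
    real (card F) \<le> C * real n ^ (k - 1) \<longrightarrow>
    (\<exists>Z U. \<beta> * real n ^ (card (hverts H) - card H) \<le> real (card (emb H F Z U)))"
proof -
  define s t \<sigma> where "s = card (hverts H)" and "t = card H" and "\<sigma> = card S"
  have fH: "finite H" using H hypertree_finite by blast
  have fVH: "finite (hverts H)" using fH H finite_hverts by blast
  have "\<sigma> \<le> t" using card_cross_cut_le[OF fH S] by (simp add: \<sigma>_def t_def)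
  have "t \<le> s" using two_contractible_ex_cross_cut(2)[OF fH H(2,3)] by (simp add: s_def t_def)
  obtain E0 where "E0 \<in> H" using hypertree_nonempty[OF H(1)] by blast
  then have "card (E0 \<inter> S) = 1" using S by (auto simp: cross_cut_def)
  then have "S \<noteq> {}" by auto
  moreover have "finite S" using S fVH by (auto simp: cross_cut_def intro: finite_subset)
  ultimately have "\<sigma> > 0" by (simp add: \<sigma>_def card_gt_0_iff)
  define K where "K = real (k - 1) ^ (k - 1)"
  have K: "K > 0" using \<open>k \<ge> 2\<close> by (simp add: K_def)
  \<comment> \<open>Edges avoiding \<open>X\<close> and edges meeting it twice may each cost
    \<open>\<gamma> / 4\<close> times the binomial; a surplus of \<open>\<gamma> / 2\<close>
    remains. \<open>K\<close> converts powers of \<open>n\<close> into binomials.\<close>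
  define \<delta> where "\<delta> = \<gamma> / (4 * K)"
  have "\<delta> > 0" using K \<open>\<gamma> > 0\<close> by (simp add: \<delta>_def)
  obtain \<epsilon> \<beta>2 n2 where \<epsilon>: "\<epsilon> > 0" and \<beta>2: "\<beta>2 > 0" and sparse: "\<forall>(V::'b set) n G. finite V \<longrightarrow> card V = n \<longrightarrow>
    n \<ge> n2 \<longrightarrow> G \<subseteq> Pow V \<longrightarrow> uniform k G \<longrightarrow> \<delta> * real n ^ (k - 1) \<le> real (card G) \<longrightarrow>
    (\<forall>v. real (hdegree G v) < \<epsilon> * real n ^ (k - 1)) \<longrightarrow>
    (\<exists>Z U. (\<beta>2 / real n) ^ card H * real n ^ card (hverts H) \<le> real (card (emb H G Z U)))"
    using card_emb_ge_no_heavy_vertex[OF \<open>k \<ge> 2\<close> H \<open>\<delta> > 0\<close>, where 'b = 'b] by (elim exE conjE) (rule that)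
  \<comment> \<open>Bounds the number of heavy vertices: the degree sum is at most
    \<open>k * C * n ^ (k - 1)\<close>, and each of them has degree at least
    \<open>\<epsilon> * n ^ (k - 1)\<close>. Adding 1 keeps \<open>M\<close> positive.\<close>
  define M where "M = nat \<lceil>real k * C / \<epsilon>\<rceil> + 1"
  have M: "M > 0" "real k * C / \<epsilon> \<le> real M" unfolding M_def by linarith+
  \<comment> \<open>The density of the common link relative to \<open>n ^ (k - 1)\<close>, from the
    pigeonhole bound with surplus \<open>\<gamma> / 2\<close>.\<close>
  define \<alpha> where "\<alpha> = \<gamma> / 2 / (real M * 2 ^ M) / K"
  have \<alpha>: "\<alpha> > 0" using \<open>\<gamma> > 0\<close> M K by (simp add: \<alpha>_def)
  define \<beta> where "\<beta> = min (\<beta>2 ^ t) ((\<alpha> / (4 * real (k - 1))) ^ t)"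
  have \<beta>: "\<beta> > 0" using \<beta>2 \<alpha> \<open>k \<ge> 2\<close> by (simp add: \<beta>_def)
  \<comment> \<open>The third summand absorbs the edges meeting \<open>X\<close> twice; the last
    makes \<open>\<alpha> * n\<close> large enough for the dense embedding into the link.\<close>
  define n0 where "n0 = n2 + k + nat \<lceil>4 * K * real M ^ 2 / \<gamma>\<rceil> + nat \<lceil>4 * real (k - 1) * real s / \<alpha>\<rceil>"
  have "\<exists>Z U. \<beta> * real n ^ (s - t) \<le> real (card (emb H F Z U))"
    if V: "finite V" "card V = n" and n: "n \<ge> n0" and F: "F \<subseteq> Pow V" "uniform k F"
      and lower: "(real \<sigma> - 1 + \<gamma>) * real (n choose (k - 1)) \<le> real (card F)"
      and upper: "real (card F) \<le> C * real n ^ (k - 1)" for V :: "'b set" and n F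
  proof -
    have fF: "finite F" using V F by (meson finite_Pow_iff finite_subset)
    have n': "n \<ge> n2" "n \<ge> k" "4 * K * real M ^ 2 / \<gamma> \<le> real n" "4 * real (k - 1) * real s / \<alpha> \<le> real n"
      using n unfolding n0_def by linarith+
    have "n > 0" using n' \<open>k \<ge> 2\<close> by simp
    define N where "N = real (n choose (k - 1))"
    have nN: "real n ^ (k - 1) \<le> K * N" unfolding K_def N_def using n' by (intro power_le_binomial) simp
    have nk: "real n ^ (k - 1) = real n * real n ^ (k - 2)"
    proof -
      have "k - 1 = Suc (k - 2)" using \<open>k \<ge> 2\<close> by simp
      then show ?thesis by simp
    qed
    define X where "X = {x \<in> V. \<epsilon> * real n ^ (k - 1) \<le> real (hdegree F x)}"
    define G where "G = {E \<in> F. E \<inter> X = {}}"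
    have XV: "X \<subseteq> V" by (auto simp: X_def)
    have fX: "finite X" using XV V(1) by (rule finite_subset)
    have pos: "\<epsilon> * real n ^ (k - 1) > 0" using \<epsilon> \<open>n > 0\<close> by simp
    have light: "\<forall>v. real (hdegree G v) < \<epsilon> * real n ^ (k - 1)"
    proof
      fix v
      show "real (hdegree G v) < \<epsilon> * real n ^ (k - 1)"
      proof (cases "v \<in> V - X")
        case True
        have "hdegree G v \<le> hdegree F v"
          unfolding hdegree_def using fF by (intro card_mono) (auto simp: G_def)
        moreover have "real (hdegree F v) < \<epsilon> * real n ^ (k - 1)" using True by (auto simp: X_def)
        ultimately show ?thesis by linarith
      next
        case False
        then have "{E \<in> G. v \<in> E} = {}" using F by (auto simp: G_def)
        then have "hdegree G v = 0" unfolding hdegree_def by (simp only: card.empty)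
        then show ?thesis using pos by simp
      qed
    qed
    have G: "G \<subseteq> Pow V" "uniform k G" "G \<subseteq> F" using F by (auto simp: G_def uniform_def)
    show ?thesis
    proof (cases "\<delta> * real n ^ (k - 1) \<le> real (card G)")
      case True
      obtain Z U where "(\<beta>2 / real n) ^ t * real n ^ s \<le> real (card (emb H G Z U))"
        using sparse[rule_format, OF V n'(1) G(1,2) True light[rule_format]] unfolding s_def t_def by blast
      moreover have "real n ^ s = real n ^ t * real n ^ (s - t)" using \<open>t \<le> s\<close> by (simp flip: power_add)
      then have "(\<beta>2 / real n) ^ t * real n ^ s = \<beta>2 ^ t * real n ^ (s - t)"
        using \<open>n > 0\<close> by (simp add: power_divide)
      moreover have "\<beta> * real n ^ (s - t) \<le> \<beta>2 ^ t * real n ^ (s - t)"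
        by (intro mult_right_mono) (auto simp: \<beta>_def)
      moreover have "card (emb H G Z U) \<le> card (emb H F Z U)"
        using card_emb_mono[OF G(3) fVH finite_hverts[OF fF F(2)]] .
      ultimately have "\<beta> * real n ^ (s - t) \<le> real (card (emb H F Z U))" by linarith
      then show ?thesis by blast
    next
      case False
      have "real (card X) * (\<epsilon> * real n ^ (k - 1)) = (\<Sum>x\<in>X. \<epsilon> * real n ^ (k - 1))" by simp
      also have "\<dots> \<le> (\<Sum>x\<in>X. real (hdegree F x))" by (intro sum_mono) (simp add: X_def)
      also have "\<dots> \<le> real k * real (card F)"
        using sum_hdegree_le[OF fF F(2) fX] by (simp flip: of_nat_sum of_nat_mult)
      also have "\<dots> \<le> real k * (C * real n ^ (k - 1))" using upper by (intro mult_left_mono) auto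
      finally have "real (card X) * (\<epsilon> * real n ^ (k - 1)) \<le> (real k * C / \<epsilon>) * (\<epsilon> * real n ^ (k - 1))"
        using \<epsilon> by simp
      then have "real (card X) \<le> real k * C / \<epsilon>" using pos by (rule mult_right_le_imp_le)
      then have cX: "card X \<le> M" using M by linarith
      define F1 where "F1 = {E \<in> F. card (E \<inter> X) = 1}"
      define F2 where "F2 = {E \<in> F. card (E \<inter> X) \<ge> 2}"
      have "F \<subseteq> G \<union> (F1 \<union> F2)"
      proof
        fix E assume E: "E \<in> F"
        have "card (E \<inter> X) = 0 \<longleftrightarrow> E \<inter> X = {}" using fX by simp
        then show "E \<in> G \<union> (F1 \<union> F2)" using E by (auto simp: G_def F1_def F2_def)
      qed
      then have "card F \<le> card (G \<union> (F1 \<union> F2))"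
        using fF by (intro card_mono) (auto simp: G_def F1_def F2_def)
      also have "\<dots> \<le> card G + (card F1 + card F2)"
        using card_Un_le[of G "F1 \<union> F2"] card_Un_le[of F1 F2] by linarith
      finally have split: "real (card F) \<le> real (card G) + real (card F1) + real (card F2)" by linarith
      have \<delta>N: "\<delta> * real n ^ (k - 1) \<le> \<gamma> / 4 * N"
      proof -
        have "\<delta> * real n ^ (k - 1) \<le> \<delta> * (K * N)" using nN \<open>\<delta> > 0\<close> by (intro mult_left_mono) auto
        also have "\<dots> = \<gamma> / 4 * N" using K by (simp add: \<delta>_def)
        finally show ?thesis .
      qed
      have "real (card F2) \<le> real M ^ 2 * real n ^ (k - 2)"
        unfolding F2_def using card_meets_twice_le[OF V F XV cX] .
      also have "real M ^ 2 \<le> \<delta> * real n"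
        using n'(3) K \<open>\<gamma> > 0\<close> by (simp add: \<delta>_def field_simps)
      then have "real M ^ 2 * real n ^ (k - 2) \<le> \<delta> * real n * real n ^ (k - 2)"
        by (intro mult_right_mono) auto
      also have "\<dots> = \<delta> * real n ^ (k - 1)" by (simp only: nk mult.assoc)
      finally have cF2: "real (card F2) \<le> \<gamma> / 4 * N" using \<delta>N by linarith
      have "(real \<sigma> - 1 + \<gamma> / 2) * N = (real \<sigma> - 1 + \<gamma>) * N - \<gamma> / 4 * N - \<gamma> / 4 * N"
        by (simp add: algebra_simps)
      then have cF1: "(real \<sigma> - 1 + \<gamma> / 2) * N \<le> real (card F1)"
        using split False cF2 \<delta>N lower unfolding N_def by linarith
      have "k - 1 \<le> n" using n' by simp
      obtain S' where S': "S' \<subseteq> X" "card S' = \<sigma>" and dense: "\<gamma> / 2 / (real M * 2 ^ M) * N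
          \<le> real (card {D. D \<subseteq> V - X \<and> card D = k - 1 \<and> (\<forall>x\<in>S'. insert x D \<in> F)})"
        using ex_dense_common_link[OF V F XV cX M(1) \<open>\<sigma> > 0\<close> _ \<open>k - 1 \<le> n\<close>, of "\<gamma> / 2"] cF1 \<open>\<gamma> > 0\<close>
        unfolding F1_def N_def by auto
      define L where "L = {D. D \<subseteq> V - X \<and> card D = k - 1 \<and> (\<forall>x\<in>S'. insert x D \<in> F)}"
      have "\<alpha> * real n * real n ^ (k - 2) = \<alpha> * real n ^ (k - 1)" by (simp only: nk mult.assoc)
      also have "\<dots> \<le> \<alpha> * (K * N)" using nN \<alpha> by (intro mult_left_mono) auto
      also have "\<dots> = \<gamma> / 2 / (real M * 2 ^ M) * N" using K by (simp add: \<alpha>_def)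
      also have "\<dots> \<le> real (card L)" using dense by (simp add: L_def)
      finally have cL: "\<alpha> * real n * real n ^ (k - 2) \<le> real (card L)" .
      \<comment> \<open>The link is \<open>(k - 1)\<close>-uniform of positive density, so the
        parameter \<open>A\<close> is \<open>\<alpha> * n\<close>, and its factor \<open>n\<close>
        cancels.\<close>
      have "(\<alpha> * real n / (4 * real (k - 1) * real n)) ^ card H * real n ^ (card (hverts H) - card S)
          \<le> real (card (emb H F {} {}))"
      proof (rule card_emb_ge_common_link[OF \<open>k \<ge> 2\<close> H S V \<open>n > 0\<close> F _ _ _ _ _ _ _ _ cL])
        show "finite S'" using S'(1) fX by (rule finite_subset)
        show "card S' = card S" using S' by (simp add: \<sigma>_def)
        show "L \<subseteq> Pow V" by (auto simp: L_def)
        show "uniform (k - 1) L" using V by (auto simp: L_def uniform_def intro: finite_subset)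
        show "D \<inter> S' = {}" if "D \<in> L" for D using that S' by (auto simp: L_def)
        show "insert x D \<in> F" if "D \<in> L" "x \<in> S'" for D x using that by (auto simp: L_def)
        show "0 < \<alpha> * real n" using \<alpha> \<open>n > 0\<close> by simp
        show "4 * real (k - 1) * real (card (hverts H)) \<le> \<alpha> * real n"
          using n'(4) \<alpha> by (simp add: s_def field_simps)
      qed
      moreover have "\<alpha> * real n / (4 * real (k - 1) * real n) = \<alpha> / (4 * real (k - 1))" using \<open>n > 0\<close> by simp
      ultimately have "(\<alpha> / (4 * real (k - 1))) ^ t * real n ^ (s - \<sigma>) \<le> real (card (emb H F {} {}))"
        by (simp add: s_def t_def \<sigma>_def)
      moreover have "\<beta> * real n ^ (s - t) \<le> (\<alpha> / (4 * real (k - 1))) ^ t * real n ^ (s - \<sigma>)"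
        using \<open>n > 0\<close> \<open>\<sigma> \<le> t\<close> \<alpha> by (intro mult_mono power_increasing) (auto simp: \<beta>_def)
      ultimately have "\<beta> * real n ^ (s - t) \<le> real (card (emb H F {} {}))" by linarith
      then show ?thesis by blast
    qed
  qed
  then show ?thesis unfolding s_def t_def \<sigma>_def by (intro exI[of _ \<beta>] exI[of _ n0] conjI allI impI \<beta>)
qed

section \<open>Combining bounded and large density\<close>

theorem theorem4p4:
  fixes k s t \<sigma> :: nat and \<gamma> :: real and H :: "'a set set"
  assumes "k \<ge> 4" and "0 < \<gamma>" and "\<gamma> < 1"
    and "k_tree k H" and "two_contractible H"
    and "s = card (hverts H)" and "t = card H" and "\<sigma> = cross_cut_number H"
  shows "\<exists>\<beta>::real. \<beta> > 0 \<and>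
    (\<exists>n\<^sub>0::nat. \<forall>n\<ge>n\<^sub>0. \<forall>(F :: nat set set) (a :: real).
       hverts F \<subseteq> {1..n} \<longrightarrow> uniform k F \<longrightarrow>
       real (card F) = a * real (n choose (k - 1)) \<longrightarrow>
       a \<ge> real \<sigma> - 1 + \<gamma> \<longrightarrow>
       real (card (copies H F)) \<ge> \<beta> * a ^ t * real n ^ (s - t))"
proof -
  have H: "hypertree H" "uniform k H" "two_contractible H" using assms by (auto simp: k_tree_def)
  have fH: "finite H" using H hypertree_finite by blast
  have fVH: "finite (hverts H)" using fH H finite_hverts by blast
  have "k \<ge> 2" "k > 0" using assms by auto
  have "t \<le> s" using two_contractible_ex_cross_cut(2)[OF fH H(2,3)] assms by simp
  have "\<exists>m. \<exists>S. cross_cut H S \<and> card S = m" using two_contractible_ex_cross_cut(1)[OF fH H(2,3)] by blast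
  then have "\<exists>S. cross_cut H S \<and> card S = \<sigma>"
    unfolding \<open>\<sigma> = cross_cut_number H\<close> cross_cut_number_def by (rule LeastI_ex)
  then obtain S where S: "cross_cut H S" "card S = \<sigma>" by blast
  have "hverts H \<noteq> {}"
  proof
    assume "hverts H = {}"
    then have "s = 0" using assms by simp
    then have "card H = 0" using \<open>t \<le> s\<close> assms by simp
    then show False using fH hypertree_nonempty[OF H(1)] by simp
  qed
  then have "s > 0" using fVH assms by (simp add: card_gt_0_iff)
  have "\<sigma> > 0"
  proof -
    obtain E where "E \<in> H" using hypertree_nonempty[OF H(1)] by blast
    then have "card (E \<inter> S) = 1" using S by (auto simp: cross_cut_def)
    then have "S \<noteq> {}" by auto
    moreover have "S \<subseteq> hverts H" using S by (simp add: cross_cut_def)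
    then have "finite S" using fVH by (rule finite_subset)
    ultimately show ?thesis using S by (auto simp: card_gt_0_iff)
  qed
  define K where "K = real (k - 1) ^ (k - 1)"
  have K: "K > 0" using \<open>k \<ge> 2\<close> by (simp add: K_def)
  \<comment> \<open>The threshold beyond which \<open>A = a / K\<close> satisfies
    \<open>A \<ge> 4 * k * s\<close>, so that the dense embedding applies without using
    \<open>\<sigma>\<close>.\<close>
  define C where "C = 4 * real k * real s * K"
  have C: "C > 0" using K \<open>k > 0\<close> \<open>s > 0\<close> by (simp add: C_def)
  obtain \<beta>1 n1 where \<beta>1: "\<beta>1 > 0" and bounded: "\<forall>(V::nat set) n F. finite V \<longrightarrow> card V = n \<longrightarrow> n \<ge> n1 \<longrightarrow>
    F \<subseteq> Pow V \<longrightarrow> uniform k F \<longrightarrow> (real (card S) - 1 + \<gamma>) * real (n choose (k - 1)) \<le> real (card F) \<longrightarrow>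
    real (card F) \<le> C * real n ^ (k - 1) \<longrightarrow>
    (\<exists>Z U. \<beta>1 * real n ^ (card (hverts H) - card H) \<le> real (card (emb H F Z U)))"
    using card_emb_ge_bounded_density[OF \<open>k \<ge> 2\<close> H S(1) \<open>0 < \<gamma>\<close> C, where 'b = nat]
    by (elim exE conjE) (rule that)
  \<comment> \<open>For \<open>a \<le> C\<close> the factor \<open>a ^ t\<close> is at most
    \<open>C ^ t\<close>, which the first entry absorbs; the second is the constant of the dense
    embedding after taking out \<open>a ^ t\<close>.\<close>
  define c where "c = min (\<beta>1 / C ^ t) ((1 / (4 * real k * K)) ^ t)"
  have c: "c > 0" using \<beta>1 C K \<open>k > 0\<close> by (simp add: c_def)
  \<comment> \<open>Division by \<open>s ^ s\<close> passes from labelled embeddings to unlabelled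
    copies.\<close>
  define \<beta> where "\<beta> = c / real s ^ s"
  have \<beta>: "\<beta> > 0" using c \<open>s > 0\<close> by (simp add: \<beta>_def)
  have "\<beta> * a ^ t * real n ^ (s - t) \<le> real (card (copies H F))"
    if n: "n \<ge> n1 + k" and FV: "hverts F \<subseteq> {1..n}" and uF: "uniform k F"
      and cF: "real (card F) = a * real (n choose (k - 1))" and a: "a \<ge> real \<sigma> - 1 + \<gamma>"
    for n a and F :: "nat set set"
  proof -
    have "n > 0" "k - 1 \<le> n" using n \<open>k > 0\<close> by auto
    have F: "F \<subseteq> Pow {1..n}" using FV by (auto simp: hverts_def)
    have fF: "finite F" using F by (rule finite_subset) simp
    have V: "finite {1..n}" "card {1..n} = n" by auto
    have a_pos: "a > 0" using a \<open>\<sigma> > 0\<close> \<open>0 < \<gamma>\<close> by linarith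
    define N where "N = real (n choose (k - 1))"
    have nN: "real n ^ (k - 1) \<le> K * N" unfolding K_def N_def using \<open>k - 1 \<le> n\<close> by (rule power_le_binomial)
    have "\<exists>Z U. c * a ^ t * real n ^ (s - t) \<le> real (card (emb H F Z U))"
    proof (cases "a \<le> C")
      case True
      have "(n choose (k - 1)) \<le> n ^ (k - 1)" using \<open>k - 1 \<le> n\<close> by (rule binomial_le_pow)
      then have Nn: "N \<le> real n ^ (k - 1)" unfolding N_def by (simp flip: of_nat_power)
      have lower: "(real (card S) - 1 + \<gamma>) * real (n choose (k - 1)) \<le> real (card F)"
        unfolding cF S(2) using a by (intro mult_right_mono) auto
      have "real (card F) = a * N" using cF by (simp add: N_def)
      also have "\<dots> \<le> C * real n ^ (k - 1)" using True Nn C a_pos by (intro mult_mono) (auto simp: N_def)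
      finally have upper: "real (card F) \<le> C * real n ^ (k - 1)" .
      have "n \<ge> n1" using n by simp
      obtain Z U where ZU: "\<beta>1 * real n ^ (s - t) \<le> real (card (emb H F Z U))"
        using bounded[rule_format, OF V \<open>n \<ge> n1\<close> F uF lower upper] assms(6,7) by blast
      have "c * a ^ t \<le> \<beta>1 / C ^ t * C ^ t"
        using True a_pos C \<beta>1 by (intro mult_mono power_mono) (auto simp: c_def)
      also have "\<dots> = \<beta>1" using C by simp
      finally have "c * a ^ t * real n ^ (s - t) \<le> \<beta>1 * real n ^ (s - t)" by (intro mult_right_mono) auto
      then show ?thesis using ZU by (meson order_trans)
    next
      case False
      \<comment> \<open>Rescales the binomial normalisation so that \<open>A * n ^ (k - 1)\<close>
        is a lower bound for \<open>card F\<close>.\<close>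
      define A where "A = a / K"
      have A: "A > 0" "A \<ge> 4 * real k * real s"
        using a_pos K False by (simp_all add: A_def C_def field_simps)
      have "A * real n ^ (k - 1) \<le> A * (K * N)" using nN A by (intro mult_left_mono) auto
      also have "\<dots> = real (card F)" using cF K by (simp add: A_def N_def)
      finally have large: "A * real n ^ (k - 1) \<le> real (card F)" .
      have "card (hverts H) \<le> s" using assms by simp
      from card_emb_ge_dense[OF V \<open>n > 0\<close> F uF \<open>k > 0\<close> H(1,2) this A large]
      have emb: "(A / (4 * real k * real n)) ^ t * real n ^ s \<le> real (card (emb H F {} {}))"
        using assms(6,7) by simp
      have "A / (4 * real k * real n) = 1 / (4 * real k * K) * a / real n" by (simp add: A_def)
      then have "(A / (4 * real k * real n)) ^ t = (1 / (4 * real k * K)) ^ t * a ^ t / real n ^ t"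
        by (simp only: power_divide power_mult_distrib)
      moreover have "real n ^ s = real n ^ t * real n ^ (s - t)" using \<open>t \<le> s\<close> by (simp flip: power_add)
      ultimately have eq: "(A / (4 * real k * real n)) ^ t * real n ^ s
          = (1 / (4 * real k * K)) ^ t * a ^ t * real n ^ (s - t)"
        using \<open>n > 0\<close> by simp
      have "c * a ^ t * real n ^ (s - t) \<le> (1 / (4 * real k * K)) ^ t * a ^ t * real n ^ (s - t)"
        using a_pos by (intro mult_right_mono) (auto simp: c_def)
      then have "c * a ^ t * real n ^ (s - t) \<le> real (card (emb H F {} {}))" using emb eq by linarith
      then show ?thesis by blast
    qed
    then obtain Z U where ZU: "c * a ^ t * real n ^ (s - t) \<le> real (card (emb H F Z U))" by blast
    also have "real (card (emb H F Z U)) \<le> real (s ^ s * card (copies H F))"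
      using card_emb_le_copies[OF fVH fF] assms(6) by (simp only: of_nat_le_iff)
    finally have "c * a ^ t * real n ^ (s - t) \<le> real s ^ s * real (card (copies H F))" by simp
    then show ?thesis using \<open>s > 0\<close> by (simp add: \<beta>_def field_simps)
  qed
  then show ?thesis by (intro exI[of _ \<beta>] exI[of _ "n1 + k"] conjI allI impI \<beta>)
qed

end
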